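(* Suppose the batch assignment satisfies Assumption 1 (stated in the context). Let $\rho = r\left(\frac12\left(\frac{c}{s\tau}\right)^2 + \frac{2}{(s\sigma)^2}\right)$. Then for every $\varepsilon \ge 0$, Algorithm 1 (with its output being the full synthetic dataset $X$) satisfies $(\varepsilon,\delta)$-differential privacy with $$\delta = \inf_{\alpha\in(1,\infty)} \frac{e^{(\alpha-1)(\alpha\rho-\varepsilon)}}{\alpha-1}\left(1-\frac1\alpha\right)^{\alpha}.$$ Moreover, for every $\delta\in(0,1]$, Algorithm 1 satisfies $(\varepsilon,\delta)$-differential privacy with $\varepsilon = \rho + \sqrt{4\rho\log(1/\delta)}$.
   Context: Let $\mathcal{X}$ be a finite token vocabulary of size $v$, containing a special end token $\texttt{<eos>}$; $\mathcal{X}^*$ denotes finite token sequences, and $\mathbf{x}_1\mathbf{x}_2$ denotes concatenation. An LLM is an arbitrary fixed function $\mathrm{logits}:\mathcal{X}^*\to\mathbb{R}^v$. For $\mathbf{z}\in\mathbb{R}^v$, $\mathrm{softmax}(\mathbf{z})$ is the distribution on $\mathcal{X}$ giving the $i$-th token probability proportional to $e^{z_i}$, and $p_{\mathbf{z}} := \mathrm{softmax}(\mathbf{z})$ (viewed as a vector in $\mathbb{R}^v$). For $c>0$ define $\mathrm{clip}_c(\mathbf{z})_i = \max\{-c,\ z_i - \max_j z_j + c\}$. A prompt is an element of $\mathcal{X}^*$; a prompt dataset is a finite set of prompts; datasets $D,D'$ are neighbors if $D = D'\cup\{\mathbf{p}\}$ or $D' = D\cup\{\mathbf{p}\}$ for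 some prompt $\mathbf{p}$. A randomized mechanism $M$ satisfies $(\varepsilon,\delta)$-differential privacy if $\Pr[M(D)\in O]\le e^{\varepsilon}\Pr[M(D')\in O]+\delta$ for all neighbors $D,D'$ and all measurable sets $O$ of outputs. $\mathrm{Laplace}(b)$ denotes a fresh independent Laplace random variable with mean $0$ and scale $b$. Parameters of Algorithm 1: the function $\mathrm{logits}$, a fixed public prompt $\mathbf{p}_{\mathrm{pub}}$, a positive number $s$ (expected batch size), a positive integer $r$, clipping bound $c>0$, temperatures $\tau>0$ and $\tau_{\mathrm{pub}}>0$, threshold $\theta\in\mathbb{R}$, noise level $\sigma>0$. For a finite set $Z\subset\mathbb{R}^v$ and $\mathbf{z}\in\mathbb{R}^v$ define $\mathrm{d}(Z,\mathbf{z}) = \left\|\frac1s\sum_{\mathbf{z}'\in Z}p_{\mathbf{z}'} - p_{\mathbf{z}}\right\|_1$. Assumption 1: there is a fixed number of batches $k$ and a fixed function $f$ from prompts to $\{1,\dots,k\}$; the $i$-th batch of a dataset $D$ is $\{\mathbf{p}\in D: f(\mathbf{p})=i\}$ (so the batch of a prompt depends only on the prompt itself). Algorithm 1 (input: prompt dataset $D$; output: set $X$ of token sequences). Set $X=\emptyset$. Independently for each batch $S$: set $\hat\theta \gets \theta+\mathrm{Laplace}(\sigma)$ and counter $t\gets 0$. Repeatedly generate examples as follows until $r$ private tokens have been sampled for this batch (generation for the batch stops immediately once $t=r$, so at most $r$ private tokens are sampled per batch): start with empty $\mathbf{x}$; while $\mathbf{x}$ does not end with $\texttt{<eos>}$ (and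 $t<r$): let $Z=\{\mathrm{logits}(\mathbf{p}\mathbf{x}):\mathbf{p}\in S\}$, $\mathbf{z}_{\mathrm{pub}} = \mathrm{logits}(\mathbf{p}_{\mathrm{pub}}\mathbf{x})$, $\hat d = \mathrm{d}(Z,\mathbf{z}_{\mathrm{pub}})+\mathrm{Laplace}(2\sigma)$. If $\hat d\ge\hat\theta$: let $\bar{\mathbf{z}} = \frac1s\sum_{\mathbf{z}\in Z}\mathrm{clip}_c(\mathbf{z})$, sample $x\sim\mathrm{softmax}(\bar{\mathbf{z}}/\tau)$, set $t\gets t+1$ and $\hat\theta\gets\theta+\mathrm{Laplace}(\sigma)$. Otherwise sample $x\sim\mathrm{softmax}(\mathbf{z}_{\mathrm{pub}}/\tau_{\mathrm{pub}})$. Append $x$ to $\mathbf{x}$. When an example is finished (or the batch stops), add $\mathbf{x}$ to $X$. Return $X$. *)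

theory Defs
  imports "HOL-Probability.Probability"
begin

text \<open>Conventions. The vocabulary is the set of tokens {..<v} (natural numbers), with a
designated end token eos < v. Token sequences and prompts are nat lists. A logit vector
in R^v is a function nat => real of which only the entries i < v matter.
The function logits is an arbitrary function from token sequences to logit vectors.\<close>

definition softmax :: "nat \<Rightarrow> (nat \<Rightarrow> real) \<Rightarrow> nat \<Rightarrow> real" where
  "softmax v z i = exp (z i) / (\<Sum>j<v. exp (z j))"

definition clip :: "nat \<Rightarrow> real \<Rightarrow> (nat \<Rightarrow> real) \<Rightarrow> nat \<Rightarrow> real" where
  "clip v c z i = max (- c) (z i - Max (z ` {..<v}) + c)"

definition dist_d :: "nat \<Rightarrow> real \<Rightarrow> (nat \<Rightarrow> real) set \<Rightarrow> (nat \<Rightarrow> real) \<Rightarrow> real" where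
  "dist_d v s Z z = (\<Sum>i<v. \<bar>(\<Sum>z'\<in>Z. softmax v z' i) / s - softmax v z i\<bar>)"

text \<open>Sampling a token from a distribution p on {..<v} by inversion of a uniform
random number u in [0,1].\<close>
definition sample_tok :: "nat \<Rightarrow> (nat \<Rightarrow> real) \<Rightarrow> real \<Rightarrow> nat" where
  "sample_tok v p u =
     (if \<exists>j<v. u < (\<Sum>i\<le>j. p i) then (LEAST j. j < v \<and> u < (\<Sum>i\<le>j. p i)) else v - 1)"

definition laplace :: "real \<Rightarrow> real measure" where
  "laplace b = density lborel (\<lambda>x. ennreal (exp (- \<bar>x\<bar> / b) / (2 * b)))"

definition uniform01 :: "real measure" where
  "uniform01 = uniform_measure lborel {0..1}"

text \<open>State of the generation for one batch: produced examples, current (unfinished)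
example, number t of private tokens sampled, current noisy threshold, stopped flag.\<close>
record gen_state =
  outs :: "nat list set"
  cur :: "nat list"
  cnt :: nat
  thr :: real
  fin :: bool

text \<open>One token-generation step of Algorithm 1 for the batch S, using fresh randomness
(eta, zeta, u): eta ~ Laplace(2 sig) for the noisy distance, zeta ~ Laplace(sig) for the
threshold refresh, u ~ Uniform[0,1] for sampling the token.\<close>
definition batch_step ::
  "(nat list \<Rightarrow> nat \<Rightarrow> real) \<Rightarrow> nat \<Rightarrow> nat \<Rightarrow> nat list \<Rightarrow> real \<Rightarrow> nat \<Rightarrow> real \<Rightarrow> real \<Rightarrow> real
   \<Rightarrow> real \<Rightarrow> nat list set \<Rightarrow> real \<times> real \<times> real \<Rightarrow> gen_state \<Rightarrow> gen_state" where
  "batch_step logits v eos ppub s r c tau taupub theta S rnd st =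
    (case rnd of (eta, zeta, u) \<Rightarrow>
     if fin st then st else
     (let x = cur st;
          Z = (\<lambda>p. logits (p @ x)) ` S;
          zpub = logits (ppub @ x);
          dh = dist_d v s Z zpub + eta
      in if dh \<ge> thr st then
           (let zbar = (\<lambda>i. (\<Sum>z\<in>Z. clip v c z i) / s);
                tok = sample_tok v (softmax v (\<lambda>i. zbar i / tau)) u;
                x' = x @ [tok];
                t' = Suc (cnt st)
            in if t' = r then
                 st\<lparr>outs := insert x' (outs st), cur := [], cnt := t', thr := theta + zeta, fin := True\<rparr>
               else if tok = eos then
                 st\<lparr>outs := insert x' (outs st), cur := [], cnt := t', thr := theta + zeta\<rparr>
               else st\<lparr>cur := x', cnt := t', thr := theta + zeta\<rparr>)
         else
           (let tok = sample_tok v (softmax v (\<lambda>i. zpub i / taupub)) u;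
                x' = x @ [tok]
            in if tok = eos then st\<lparr>outs := insert x' (outs st), cur := []\<rparr>
               else st\<lparr>cur := x'\<rparr>)))"

fun batch_run ::
  "(nat list \<Rightarrow> nat \<Rightarrow> real) \<Rightarrow> nat \<Rightarrow> nat \<Rightarrow> nat list \<Rightarrow> real \<Rightarrow> nat \<Rightarrow> real \<Rightarrow> real \<Rightarrow> real
   \<Rightarrow> real \<Rightarrow> nat list set \<Rightarrow> real \<Rightarrow> (real \<times> real \<times> real) stream \<Rightarrow> nat \<Rightarrow> gen_state" where
  "batch_run logits v eos ppub s r c tau taupub theta S th0 \<omega> 0 =
     \<lparr>outs = {}, cur = [], cnt = 0, thr = theta + th0, fin = False\<rparr>"
| "batch_run logits v eos ppub s r c tau taupub theta S th0 \<omega> (Suc n) =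
     batch_step logits v eos ppub s r c tau taupub theta S (\<omega> !! n)
       (batch_run logits v eos ppub s r c tau taupub theta S th0 \<omega> n)"

definition batch_out ::
  "(nat list \<Rightarrow> nat \<Rightarrow> real) \<Rightarrow> nat \<Rightarrow> nat \<Rightarrow> nat list \<Rightarrow> real \<Rightarrow> nat \<Rightarrow> real \<Rightarrow> real \<Rightarrow> real
   \<Rightarrow> real \<Rightarrow> nat list set \<Rightarrow> real \<times> (real \<times> real \<times> real) stream \<Rightarrow> nat list set option" where
  "batch_out logits v eos ppub s r c tau taupub theta S \<omega>b =
    (case \<omega>b of (th0, \<omega>) \<Rightarrow>
      if \<exists>n. fin (batch_run logits v eos ppub s r c tau taupub theta S th0 \<omega> n)
      then Some (outs (batch_run logits v eos ppub s r c tau taupub theta S th0 \<omega>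
                  (LEAST n. fin (batch_run logits v eos ppub s r c tau taupub theta S th0 \<omega> n))))
      else None)"

definition batch_space :: "real \<Rightarrow> (real \<times> (real \<times> real \<times> real) stream) measure" where
  "batch_space sig =
     laplace sig \<Otimes>\<^sub>M stream_space (laplace (2 * sig) \<Otimes>\<^sub>M (laplace sig \<Otimes>\<^sub>M uniform01))"

definition alg1_space :: "nat \<Rightarrow> real \<Rightarrow> (nat \<Rightarrow> real \<times> (real \<times> real \<times> real) stream) measure" where
  "alg1_space k sig = PiM {1..k} (\<lambda>_. batch_space sig)"

definition alg1_out ::
  "(nat list \<Rightarrow> nat \<Rightarrow> real) \<Rightarrow> nat \<Rightarrow> nat \<Rightarrow> nat list \<Rightarrow> real \<Rightarrow> nat \<Rightarrow> real \<Rightarrow> real \<Rightarrow> real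
   \<Rightarrow> real \<Rightarrow> (nat list \<Rightarrow> nat) \<Rightarrow> nat \<Rightarrow> nat list set
   \<Rightarrow> (nat \<Rightarrow> real \<times> (real \<times> real \<times> real) stream) \<Rightarrow> nat list set option" where
  "alg1_out logits v eos ppub s r c tau taupub theta f k D \<omega> =
    (let res = (\<lambda>i. batch_out logits v eos ppub s r c tau taupub theta {p \<in> D. f p = i} (\<omega> i))
     in if \<forall>i\<in>{1..k}. res i \<noteq> None then Some (\<Union>i\<in>{1..k}. the (res i)) else None)"

definition alg1 ::
  "(nat list \<Rightarrow> nat \<Rightarrow> real) \<Rightarrow> nat \<Rightarrow> nat \<Rightarrow> nat list \<Rightarrow> real \<Rightarrow> nat \<Rightarrow> real \<Rightarrow> real \<Rightarrow> real
   \<Rightarrow> real \<Rightarrow> real \<Rightarrow> (nat list \<Rightarrow> nat) \<Rightarrow> nat \<Rightarrow> nat list set \<Rightarrow> nat list set option measure" where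
  "alg1 logits v eos ppub s r c tau taupub theta sig f k D =
     distr (alg1_space k sig) (count_space UNIV)
       (alg1_out logits v eos ppub s r c tau taupub theta f k D)"

definition neighbors :: "'a set \<Rightarrow> 'a set \<Rightarrow> bool" where
  "neighbors D D' \<longleftrightarrow> (\<exists>p. D = D' \<union> {p} \<or> D' = D \<union> {p})"

definition dp :: "nat \<Rightarrow> (nat list set \<Rightarrow> 'b measure) \<Rightarrow> real \<Rightarrow> real \<Rightarrow> bool" where
  "dp v M eps delta \<longleftrightarrow>
    (\<forall>D D'. finite D \<and> finite D' \<and> (\<forall>p\<in>D \<union> D'. set p \<subseteq> {..<v}) \<and> neighbors D D' \<longrightarrow>
       (\<forall>E \<in> sets (M D). measure (M D) E \<le> exp eps * measure (M D') E + delta))"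

end

theory Submission
  imports Defs
begin

text \<open>Only one batch differs between neighboring datasets. For a fixed event, let u and w be its
probabilities under the two versions of that batch. It suffices to prove the Holder form
$u \le e^{(\alpha-1)\rho} w^{1-1/\alpha}$ of a Renyi bound: Young's inequality turns it into the stated
differential privacy inequality. In contrast to a sum of likelihood ratios over transcripts, this form
composes by induction on the number of remaining private tokens, on value functions alone.

One round is a sparse vector search followed by a private token. The search is $2/(s\sigma)$-differentially
private as a functional of the payoff, by shifting the noisy threshold by the sensitivity 1/s, and pure
differential privacy implies the Holder form by a reduction to randomized response. The private token
satisfies it by a bound on cumulant generating functions.

Everything is done for runs cut off after n tokens, where nontermination is the event of not having
finished; the bounds are uniform in n.\<close>

section \<open>Holder form of Renyi bounds\<close>

text \<open>With \<open>g = 1 - 1 / alpha\<close>, the bound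
  \<open>u <= exp ((alpha - 1) * rho) * w powr g\<close> is what a Renyi divergence of order alpha,
  bounded by \<open>alpha * rho\<close>, leaves of a single event. Bounded payoffs in place of
  events make it inductive: if continuation values satisfy \<open>U <= K * U' powr g\<close>, a
  stage only has to move the power outside its expectation at the price of a constant factor, and g
  stays the same from stage to stage. The obstacle is the noisy threshold. It is shared by all
  comparisons of a search, and charging each comparison separately would cost a factor growing with
  the number of public tokens. A whole search is therefore one mechanism. Public tokens are free
  because their distribution does not depend on the batch, and refreshing the threshold after a
  private token makes every search start anew. Each round contributes two terms to rho:
  \<open>e\<^sup>2 / 2\<close> with \<open>e = 2 / (s * sig)\<close> for the search, and
  \<open>eta\<^sup>2 / 2\<close> with \<open>eta = c / (s * tau)\<close> for the private
  token.\<close>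

lemma powr_mult_le_weighted_sum:
  fixes a b g :: real
  assumes "0 \<le> g" "g \<le> 1" "a \<ge> 0" "b \<ge> 0"
  shows "a powr (1 - g) * b powr g \<le> (1 - g) * a + g * b"
proof (cases "a = 0 \<or> b = 0")
  case False
  then show ?thesis using Youngs_inequality_0[of "1 - g" g a b] assms by simp
qed (use assms in auto)

text \<open>For probability weights, the first factor on the right is
  \<open>exp ((1 - 1 / alpha) * R)\<close> with R the Renyi divergence of order alpha of p from q. A
  power inside an expectation under p is traded for a power outside an expectation under q.\<close>

lemma Holder_sum_powr:
  fixes p q x :: "'i \<Rightarrow> real"
  assumes "finite I" "alpha > 1"
    and p: "\<And>i. i \<in> I \<Longrightarrow> p i \<ge> 0" and q: "\<And>i. i \<in> I \<Longrightarrow> q i > 0"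
    and x: "\<And>i. i \<in> I \<Longrightarrow> x i \<ge> 0"
  shows "(\<Sum>i\<in>I. p i * x i powr (1 - 1 / alpha))
    \<le> (\<Sum>i\<in>I. p i powr alpha * q i powr (1 - alpha)) powr (1 / alpha)
        * (\<Sum>i\<in>I. q i * x i) powr (1 - 1 / alpha)"
proof -
  define u where "u i = p i powr alpha * q i powr (1 - alpha)" for i
  define R where "R = (\<Sum>i\<in>I. u i)"
  define W where "W = (\<Sum>i\<in>I. q i * x i)"
  define g where "g = 1 - 1 / alpha"
  have g: "0 < g" "g < 1" "1 / alpha = 1 - g" using \<open>alpha > 1\<close> by (auto simp: g_def field_simps)
  have u: "u i \<ge> 0" if "i \<in> I" for i using that by (simp add: u_def)
  have qx: "q i * x i \<ge> 0" if "i \<in> I" for i using q[OF that] x[OF that] by simp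
  \<comment> \<open>The exponents are conjugate: the powers of \<open>q i\<close> cancel and
    \<open>p i\<close> comes out with exponent 1.\<close>
  have id: "p i * x i powr g = u i powr (1 - g) * (q i * x i) powr g" if i: "i \<in> I" for i
  proof -
    have "u i powr (1 - g) = p i powr (alpha * (1 - g)) * q i powr ((1 - alpha) * (1 - g))"
      unfolding u_def using q[OF i] p[OF i] by (simp add: powr_mult powr_powr)
    moreover have "alpha * (1 - g) = 1" "(1 - alpha) * (1 - g) = - g"
      using \<open>alpha > 1\<close> by (auto simp: g_def field_simps)
    ultimately have "u i powr (1 - g) = p i * q i powr (- g)"
      using p[OF i] by simp
    then show ?thesis using q[OF i] x[OF i] by (simp add: powr_mult powr_minus)
  qed
  show ?thesis
  proof (cases "R = 0 \<or> W = 0")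
    \<comment> \<open>Young's inequality is applied below to terms divided by R and W, so vanishing
      sums are treated apart; here every summand has a vanishing factor.\<close>
    case True
    have "p i * x i powr g = 0" if i: "i \<in> I" for i
    proof -
      have "u i = 0 \<or> q i * x i = 0"
        using True i u qx \<open>finite I\<close> unfolding R_def W_def
        by (metis (no_types, lifting) sum_nonneg_eq_0_iff)
      then show ?thesis using id[OF i] by auto
    qed
    then have "(\<Sum>i\<in>I. p i * x i powr g) = 0" by (intro sum.neutral) simp
    then show ?thesis unfolding g_def by simp
  next
    case False
    have "R \<ge> 0" "W \<ge> 0" unfolding R_def W_def using u qx by (auto intro: sum_nonneg)
    with False have RW: "R > 0" "W > 0" by auto
    \<comment> \<open>Dividing by R and W makes the weighted terms on the right add up to
      \<open>(1 - g) + g = 1\<close>.\<close>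
    have "p i * x i powr g \<le> R powr (1 - g) * W powr g * ((1 - g) * (u i / R) + g * (q i * x i / W))"
      if i: "i \<in> I" for i
    proof -
      have "p i * x i powr g = R powr (1 - g) * W powr g * ((u i / R) powr (1 - g) * (q i * x i / W) powr g)"
        using RW u[OF i] qx[OF i] by (simp add: id[OF i] powr_divide)
      also have "\<dots> \<le> R powr (1 - g) * W powr g * ((1 - g) * (u i / R) + g * (q i * x i / W))"
        using RW u[OF i] qx[OF i] g
        by (intro mult_left_mono powr_mult_le_weighted_sum) auto
      finally show ?thesis .
    qed
    then have "(\<Sum>i\<in>I. p i * x i powr g)
      \<le> (\<Sum>i\<in>I. R powr (1 - g) * W powr g * ((1 - g) * (u i / R) + g * (q i * x i / W)))"
      by (rule sum_mono)
    also have "\<dots> = R powr (1 - g) * W powr g * ((1 - g) * (R / R) + g * (W / W))"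
      by (simp only: R_def W_def sum.distrib sum_distrib_left sum_divide_distrib distrib_left)
    also have "\<dots> = R powr (1 - g) * W powr g" using RW by simp
    finally show ?thesis unfolding R_def W_def u_def g(3) by simp
  qed
qed

lemma Holder_two_powr:
  fixes p q x y :: real
  assumes "alpha > 1" "0 \<le> p" "0 \<le> p'" "0 < q" "0 < q'" "0 \<le> x" "0 \<le> y"
  shows "p * x powr (1 - 1 / alpha) + p' * y powr (1 - 1 / alpha)
    \<le> (p powr alpha * q powr (1 - alpha) + p' powr alpha * q' powr (1 - alpha)) powr (1 / alpha)
       * (q * x + q' * y) powr (1 - 1 / alpha)"
proof -
  have "(\<Sum>b\<in>{True, False}. (if b then p else p') * (if b then x else y) powr (1 - 1 / alpha))
    \<le> (\<Sum>b\<in>{True, False}. (if b then p else p') powr alpha * (if b then q else q') powr (1 - alpha)) powr (1 / alpha)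
       * (\<Sum>b\<in>{True, False}. (if b then q else q') * (if b then x else y)) powr (1 - 1 / alpha)"
    using assms by (intro Holder_sum_powr) auto
  then show ?thesis by simp
qed

section \<open>Renyi divergence of randomized response\<close>

lemma sinh_le_mult_cosh: "x \<ge> 0 \<Longrightarrow> sinh x \<le> x * cosh (x::real)"
  using DERIV_nonneg_imp_nondecreasing[of 0 x "\<lambda>x. x * cosh x - sinh x"]
  by (force intro!: exI derivative_eq_intros simp: mult_nonneg_nonneg)

text \<open>The logarithm has derivative \<open>tanh y - y\<close>, which is nonpositive for y \<ge>
  0. The Gaussian factor turns a quotient of two values of cosh into an exponential bound.\<close>

lemma cosh_mult_gauss_antimono:
  fixes x y :: real
  assumes "0 \<le> x" "x \<le> y"
  shows "cosh y * exp (- y\<^sup>2 / 2) \<le> cosh x * exp (- x\<^sup>2 / 2)"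
proof (rule DERIV_nonpos_imp_nonincreasing[OF assms(2)])
  fix t assume "x \<le> t" "t \<le> y"
  then have "sinh t \<le> t * cosh t" using assms sinh_le_mult_cosh by simp
  moreover have "((\<lambda>t. cosh t * exp (- t\<^sup>2 / 2)) has_real_derivative
      exp (- t\<^sup>2 / 2) * (sinh t - t * cosh t)) (at t)"
    by (auto intro!: derivative_eq_intros simp: algebra_simps)
  ultimately show "\<exists>d. ((\<lambda>t. cosh t * exp (- t\<^sup>2 / 2)) has_real_derivative d) (at t) \<and> d \<le> 0"
    by (intro exI[of _ "exp (- t\<^sup>2 / 2) * (sinh t - t * cosh t)"]) (auto simp: mult_nonneg_nonpos)
qed

text \<open>The left-hand side is the Renyi sum, of order alpha, of e-randomized response against its mirror image.\<close>
lemma randomized_response_renyi_le: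
  fixes e alpha :: real
  assumes "e \<ge> 0" "alpha > 1"
  defines "p \<equiv> exp e / (1 + exp e)"
  shows "p powr alpha * (1 - p) powr (1 - alpha) + (1 - p) powr alpha * p powr (1 - alpha)
     \<le> exp (alpha * (alpha - 1) * e\<^sup>2 / 2)"
proof -
  have E: "1 + exp e > 0" by (simp add: add_pos_pos)
  have p1: "1 - p = 1 / (1 + exp e)" using E by (simp add: p_def field_simps)
  have "p powr alpha * (1 - p) powr (1 - alpha) = exp (alpha * e) / (1 + exp e)"
    using E unfolding p1 unfolding p_def 
    by (simp add: powr_divide flip: powr_add) (simp add: powr_def)
  moreover have "(1 - p) powr alpha * p powr (1 - alpha) = exp ((1 - alpha) * e) / (1 + exp e)"
    using E unfolding p1 unfolding p_def 
    by (simp add: powr_divide flip: powr_add) (simp add: powr_def)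
  \<comment> \<open>Both exponents lie symmetrically about \<open>e / 2\<close>, at distance
    \<open>(alpha - 1/2) * e\<close>.\<close>
  moreover have "exp (alpha * e) + exp ((1 - alpha) * e) = 2 * exp (e / 2) * cosh ((alpha - 1/2) * e)"
    by (simp add: cosh_def algebra_simps flip: exp_add)
  moreover have "1 + exp e = 2 * exp (e / 2) * cosh (e / 2)"
    by (simp add: cosh_def algebra_simps flip: exp_add)
  ultimately have eq: "p powr alpha * (1 - p) powr (1 - alpha) + (1 - p) powr alpha * p powr (1 - alpha)
     = cosh ((alpha - 1/2) * e) / cosh (e / 2)"
    by (simp add: add_divide_distrib[symmetric])
  have "e / 2 \<le> (alpha - 1/2) * e" using assms mult_right_mono[of 1 alpha e] by (simp add: algebra_simps)
  then have "cosh ((alpha - 1/2) * e) * exp (- ((alpha - 1/2) * e)\<^sup>2 / 2)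
     \<le> cosh (e / 2) * exp (- (e / 2)\<^sup>2 / 2)"
    using assms by (intro cosh_mult_gauss_antimono) auto
  then have "cosh ((alpha - 1/2) * e) \<le> cosh (e / 2) * (exp (- (e / 2)\<^sup>2 / 2) / exp (- ((alpha - 1/2) * e)\<^sup>2 / 2))"
    by (simp add: field_simps)
  \<comment> \<open>Exact, because
    \<open>(alpha - 1/2)\<^sup>2 - (1/2)\<^sup>2 = alpha * (alpha - 1)\<close>.\<close>
  also have "exp (- (e / 2)\<^sup>2 / 2) / exp (- ((alpha - 1/2) * e)\<^sup>2 / 2) = exp (alpha * (alpha - 1) * e\<^sup>2 / 2)"
    by (simp flip: exp_diff) (simp add: power2_eq_square field_simps)
  finally show ?thesis unfolding eq by (simp add: field_simps)
qed

section \<open>Exponential tilting and softmax\<close>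

text \<open>The second derivative of the cumulant generating function is the variance of h under the
  tilted weights \<open>q i * exp (t * h i)\<close>, hence at most \<open>eta\<^sup>2\<close>.
  Subtracting \<open>t\<^sup>2 * eta\<^sup>2 / 2\<close> leaves a concave function vanishing at 0,
  whose value at alpha is at most alpha times its value at 1.\<close>

lemma mgf_power_le:
  fixes q h :: "'i \<Rightarrow> real"
  assumes "finite I" "I \<noteq> {}" "alpha > 1"
    and q: "\<And>i. i \<in> I \<Longrightarrow> q i > 0" and q1: "(\<Sum>i\<in>I. q i) = 1"
    and h: "\<And>i. i \<in> I \<Longrightarrow> \<bar>h i\<bar> \<le> eta"
  shows "(\<Sum>i\<in>I. q i * exp (alpha * h i))
    \<le> exp (alpha * (alpha - 1) * eta\<^sup>2 / 2) * (\<Sum>i\<in>I. q i * exp (h i)) powr alpha"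
proof -
  define m0 where "m0 t = (\<Sum>i\<in>I. q i * exp (t * h i))" for t
  define m1 where "m1 t = (\<Sum>i\<in>I. q i * h i * exp (t * h i))" for t
  define m2 where "m2 t = (\<Sum>i\<in>I. q i * (h i)\<^sup>2 * exp (t * h i))" for t
  have m0: "m0 t > 0" for t unfolding m0_def using assms by (intro sum_pos) auto
  have d0: "(m0 has_real_derivative m1 t) (at t)" for t
    unfolding m0_def[abs_def] m1_def 
    by (auto intro!: derivative_eq_intros DERIV_sum simp: algebra_simps)
  have d1: "(m1 has_real_derivative m2 t) (at t)" for t
    unfolding m1_def[abs_def] m2_def 
    by (auto intro!: derivative_eq_intros DERIV_sum simp: algebra_simps power2_eq_square)
  have m2: "m2 t \<le> eta\<^sup>2 * m0 t" for t
  proof -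
    have "q i * (h i)\<^sup>2 * exp (t * h i) \<le> eta\<^sup>2 * (q i * exp (t * h i))" if "i \<in> I" for i
    proof -
      have "(h i)\<^sup>2 \<le> eta\<^sup>2" using h[OF that] by (metis abs_ge_zero power2_abs power_mono)
      then show ?thesis using q[OF that]
        by (simp add: mult.assoc mult.left_commute mult_left_mono mult_right_mono)
    qed
    then show ?thesis unfolding m2_def m0_def sum_distrib_left by (rule sum_mono)
  qed
  define G where "G t = ln (m0 t) - t\<^sup>2 * eta\<^sup>2 / 2" for t
  have "concave_on UNIV G"
  proof (rule f''_le0_imp_concave)
    show "(G has_real_derivative m1 t / m0 t - t * eta\<^sup>2) (at t)" for t
      unfolding G_def[abs_def] using m0[of t]
      by (auto intro!: derivative_eq_intros d0 simp: field_simps)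
    show "((\<lambda>t. m1 t / m0 t - t * eta\<^sup>2) has_real_derivative
        (m2 t * m0 t - m1 t * m1 t) / (m0 t * m0 t) - eta\<^sup>2) (at t)" for t
      using m0[of t] by (auto intro!: derivative_eq_intros d0 d1)
    show "(m2 t * m0 t - m1 t * m1 t) / (m0 t * m0 t) - eta\<^sup>2 \<le> 0" for t
    proof -
      \<comment> \<open>The variance is bounded by the second moment; the square of the mean is
        dropped.\<close>
      have "m2 t * m0 t \<le> eta\<^sup>2 * (m0 t * m0 t)"
        using mult_right_mono[OF m2, of "m0 t" t] m0[of t] by (simp add: mult.assoc)
      then have "m2 t * m0 t - m1 t * m1 t \<le> eta\<^sup>2 * (m0 t * m0 t)"
        using zero_le_square[of "m1 t"] by linarith
      moreover have "m0 t * m0 t > 0" using m0[of t] by simp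
      ultimately show ?thesis by (simp only: pos_divide_le_eq diff_le_0_iff_le)
    qed
  qed simp
  from concave_onD[OF this, of "1 / alpha" 0 alpha] have "G 1 \<ge> (1 - 1 / alpha) * G 0 + (1 / alpha) * G alpha"
    using \<open>alpha > 1\<close> by simp
  moreover have "G 0 = 0" by (simp add: G_def m0_def q1)
  ultimately have "G alpha \<le> alpha * G 1" using \<open>alpha > 1\<close> by (simp add: field_simps)
  then have "ln (m0 alpha) \<le> alpha * (alpha - 1) * eta\<^sup>2 / 2 + alpha * ln (m0 1)"
    by (simp add: G_def power2_eq_square field_simps)
  then have "m0 alpha \<le> exp (alpha * (alpha - 1) * eta\<^sup>2 / 2 + alpha * ln (m0 1))"
    using m0[of alpha] by (metis exp_le_cancel_iff exp_ln)
  also have "\<dots> = exp (alpha * (alpha - 1) * eta\<^sup>2 / 2) * m0 1 powr alpha"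
    using m0[of 1] by (simp add: exp_add powr_def)
  finally show ?thesis by (simp add: m0_def)
qed

lemma softmax_pos: "v > 0 \<Longrightarrow> softmax v z i > 0"
  unfolding softmax_def by (intro divide_pos_pos sum_pos) auto

lemma sum_softmax: "v > 0 \<Longrightarrow> (\<Sum>i<v. softmax v z i) = 1"
proof -
  assume "v > 0"
  then have "(\<Sum>j<v. exp (z j)) > 0" by (intro sum_pos) auto
  then show ?thesis unfolding softmax_def sum_divide_distrib[symmetric] by simp
qed

text \<open>A perturbation h of the logits with entries at most eta gives a likelihood ratio
$e^{h_i} / E(e^h)$. Its logarithm can be as large as 2 eta, but bounding the second derivative of the
cumulant generating function by $\eta^2$ beats the resulting pure bound by a factor of 4.\<close>
lemma softmax_renyi_le:
  assumes "v > 0" "alpha > 1" and z: "\<And>i. i < v \<Longrightarrow> \<bar>z i - z' i\<bar> \<le> eta"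
  shows "(\<Sum>i<v. softmax v z i powr alpha * softmax v z' i powr (1 - alpha))
    \<le> exp (alpha * (alpha - 1) * eta\<^sup>2 / 2)"
proof -
  define S where "S = (\<Sum>j<v. exp (z j))"
  define S' where "S' = (\<Sum>j<v. exp (z' j))"
  have S: "S > 0" "S' > 0" unfolding S_def S'_def using \<open>v > 0\<close> by (auto intro!: sum_pos)
  \<comment> \<open>The total mass after tilting, equal to the quotient of the two partition
    functions; \<open>softmax v z\<close> is the tilted \<open>softmax v z'\<close> divided by
    M.\<close>
  define M where "M = (\<Sum>i<v. softmax v z' i * exp (z i - z' i))"
  have M: "M = S / S'"
    unfolding M_def softmax_def S'_def[symmetric] S_def sum_divide_distrib
    by (simp flip: exp_add)
  have "softmax v z i powr alpha * softmax v z' i powr (1 - alpha)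
     = softmax v z' i * exp (alpha * (z i - z' i)) / M powr alpha" for i
  proof -
    have "softmax v z i = softmax v z' i * exp (z i - z' i) / M"
      using S unfolding M softmax_def S_def[symmetric] S'_def[symmetric] by (simp add: exp_diff)
    then show ?thesis using softmax_pos[OF \<open>v > 0\<close>, of z' i] S
      by (simp add: powr_divide powr_mult M powr_diff) (simp add: powr_def)
  qed
  then have "(\<Sum>i<v. softmax v z i powr alpha * softmax v z' i powr (1 - alpha))
     = (\<Sum>i<v. softmax v z' i * exp (alpha * (z i - z' i))) / M powr alpha"
    by (simp add: sum_divide_distrib)
  also have "\<dots> \<le> exp (alpha * (alpha - 1) * eta\<^sup>2 / 2)"
    using mgf_power_le[of "{..<v}" alpha "softmax v z'" "\<lambda>i. z i - z' i" eta]
      assms softmax_pos sum_softmax S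
    by (auto simp: M_def[symmetric] divide_le_eq M)
  finally show ?thesis .
qed

section \<open>Positive linear functionals and pure differential privacy\<close>

definition bounded_real_fun :: "('a \<Rightarrow> real) \<Rightarrow> bool" where
  "bounded_real_fun f \<longleftrightarrow> (\<exists>B. \<forall>x. \<bar>f x\<bar> \<le> B)"

lemma bounded_real_funI: "(\<And>x. \<bar>f x\<bar> \<le> B) \<Longrightarrow> bounded_real_fun f"
  unfolding bounded_real_fun_def by blast

lemma bounded_real_fun_lincomb:
  assumes "bounded_real_fun f" "bounded_real_fun g"
  shows "bounded_real_fun (\<lambda>x. a * f x + b * g x)"
proof -
  obtain B C where B: "\<And>x. \<bar>f x\<bar> \<le> B" and C: "\<And>x. \<bar>g x\<bar> \<le> C"
    using assms unfolding bounded_real_fun_def by blast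
  have "\<bar>a * f x + b * g x\<bar> \<le> \<bar>a\<bar> * B + \<bar>b\<bar> * C" for x
  proof -
    have "\<bar>a * f x + b * g x\<bar> \<le> \<bar>a\<bar> * \<bar>f x\<bar> + \<bar>b\<bar> * \<bar>g x\<bar>"
      by (metis abs_mult abs_triangle_ineq)
    also have "\<dots> \<le> \<bar>a\<bar> * B + \<bar>b\<bar> * C" using B C by (intro add_mono mult_left_mono) auto
    finally show ?thesis .
  qed
  then show ?thesis by (rule bounded_real_funI)
qed

lemma bounded_real_fun_const: "bounded_real_fun (\<lambda>x. c)"
  by (rule bounded_real_funI[of _ "\<bar>c\<bar>"]) simp

lemma bounded_real_fun_powr:
  assumes "bounded_real_fun H" "\<And>x. H x \<ge> 0" "g \<ge> 0"
  shows "bounded_real_fun (\<lambda>x. H x powr g)"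
proof -
  obtain B where B: "\<And>x. \<bar>H x\<bar> \<le> B" using assms unfolding bounded_real_fun_def by blast
  have "\<bar>H x powr g\<bar> \<le> B powr g" for x
    using B[of x] assms by (auto intro: powr_mono2)
  then show ?thesis by (rule bounded_real_funI)
qed

text \<open>The argument type carries no sigma-algebra: in the searches to which this is applied,
  the payoff enters only through finite sums and an integral over the threshold. Linearity is
  demanded on bounded functions only, where that integral exists.\<close>

definition linear_expectation :: "(('a \<Rightarrow> real) \<Rightarrow> real) \<Rightarrow> bool" where
  "linear_expectation P \<longleftrightarrow>
     (\<forall>f g a b. bounded_real_fun f \<longrightarrow> bounded_real_fun g \<longrightarrow>
        P (\<lambda>x. a * f x + b * g x) = a * P f + b * P g) \<and>
     P (\<lambda>_. 1) = 1 \<and>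
     (\<forall>f. bounded_real_fun f \<longrightarrow> (\<forall>x. f x \<ge> 0) \<longrightarrow> P f \<ge> 0)"

lemma linear_expectation_lincomb:
  "linear_expectation P \<Longrightarrow> bounded_real_fun f \<Longrightarrow> bounded_real_fun g \<Longrightarrow>
     P (\<lambda>x. a * f x + b * g x) = a * P f + b * P g"
  by (simp add: linear_expectation_def)

lemma linear_expectation_mono:
  assumes P: "linear_expectation P" and f: "bounded_real_fun f" and g: "bounded_real_fun g"
    and le: "\<And>x. f x \<le> g x"
  shows "P f \<le> P g"
proof -
  have pos: "P h \<ge> 0" if "bounded_real_fun h" "\<forall>x. h x \<ge> 0" for h
    using P that by (simp add: linear_expectation_def)
  have "P (\<lambda>x. 1 * g x + (-1) * f x) \<ge> 0"
    by (rule pos[OF bounded_real_fun_lincomb[OF g f]]) (simp add: le)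
  then show ?thesis using linear_expectation_lincomb[OF P g f, of 1 "-1"] by simp
qed

text \<open>The functional comes without a measure, so concavity of the power is used through
  tangents: \<open>t powr (1 - g) * y powr g <= (1 - g) * t + g * y\<close> is affine in y on the
  right and survives A. Then t is set to \<open>A H\<close>.\<close>

lemma linear_expectation_Jensen_powr:
  assumes A: "linear_expectation A" and H: "bounded_real_fun H" "\<And>x. H x \<ge> 0"
    and g: "0 < g" "g < 1"
  shows "A (\<lambda>x. H x powr g) \<le> A H powr g"
proof -
  define y where "y = A (\<lambda>x. H x powr g)"
  have bd: "bounded_real_fun (\<lambda>x. H x powr g)" using H g by (intro bounded_real_fun_powr) auto
  have A0: "A H \<ge> 0" using A H by (simp add: linear_expectation_def)
  have tangent: "t powr (1 - g) * y \<le> (1 - g) * t + g * A H" if "t \<ge> 0" for t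
  proof -
    \<comment> \<open>The summand \<open>0 * 1\<close> pads the expression to the two-term
      combinations for which linearity is stated.\<close>
    have "t powr (1 - g) * y = A (\<lambda>x. t powr (1 - g) * H x powr g + 0 * 1)"
      using linear_expectation_lincomb[OF A bd bounded_real_fun_const, of _ 0 1] by (simp add: y_def)
    also have "\<dots> \<le> A (\<lambda>x. g * H x + ((1 - g) * t) * 1)"
    proof (rule linear_expectation_mono[OF A])
      show "t powr (1 - g) * H x powr g + 0 * 1 \<le> g * H x + ((1 - g) * t) * 1" for x
        using powr_mult_le_weighted_sum[of g t "H x"] g that H by simp
    qed (rule bounded_real_fun_lincomb bounded_real_fun_const H bd)+
    also have "\<dots> = g * A H + (1 - g) * t"
      using linear_expectation_lincomb[OF A H(1) bounded_real_fun_const, of g "(1 - g) * t" 1] A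
      by (simp add: linear_expectation_def)
    finally show ?thesis by simp
  qed
  show ?thesis
  proof (cases "A H = 0")
    case True
    have "y \<le> 0"
    proof (rule ccontr)
      assume "\<not> y \<le> 0"
      then have y: "y > 0" by simp
      \<comment> \<open>With \<open>y = t powr g\<close> the tangent inequality reads
        \<open>t <= (1 - g) * t\<close>, which fails for t > 0.\<close>
      define t where "t = y powr (1 / g)"
      have "t > 0" using y by (simp add: t_def)
      have "y = t powr g" using y g by (simp add: t_def powr_powr)
      then have "t powr (1 - g) * y = t" using \<open>t > 0\<close> by (simp flip: powr_add)
      then have "g * t \<le> 0" using tangent[of t] \<open>t > 0\<close> True by (simp add: algebra_simps)
      then show False using \<open>t > 0\<close> g by (simp add: mult_le_0_iff)
    qed
    then show ?thesis using True by (simp add: y_def)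
  next
    case False
    with A0 have a: "A H > 0" by simp
    have "A H powr (1 - g) * y \<le> A H" using tangent[of "A H"] A0 by (simp add: algebra_simps)
    also have "\<dots> = A H powr (1 - g) * A H powr g" using a by (simp flip: powr_add)
    finally show ?thesis using a by (simp add: y_def)
  qed
qed

text \<open>The functionals A and B in the proof exhibit P and Q as randomized response followed by
post-processing, which reduces the inequality to two points without using densities.\<close>
lemma pure_dp_imp_Holder:
  fixes P Q :: "('a \<Rightarrow> real) \<Rightarrow> real"
  assumes P: "linear_expectation P" and Q: "linear_expectation Q"
    and PQ: "\<And>f. bounded_real_fun f \<Longrightarrow> (\<And>x. f x \<ge> 0) \<Longrightarrow> P f \<le> exp e * Q f"
    and QP: "\<And>f. bounded_real_fun f \<Longrightarrow> (\<And>x. f x \<ge> 0) \<Longrightarrow> Q f \<le> exp e * P f"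
    and H: "bounded_real_fun H" "\<And>x. H x \<ge> 0" and e: "e > 0" and alpha: "alpha > 1"
  shows "P (\<lambda>x. H x powr (1 - 1 / alpha))
    \<le> exp ((alpha - 1) * e\<^sup>2 / 2) * Q H powr (1 - 1 / alpha)"
proof -
  define E where "E = exp e"
  have E: "E > 1" using e by (simp add: E_def)
  \<comment> \<open>A and B solve \<open>P = p A + (1 - p) B\<close> and
    \<open>Q = (1 - p) A + p B\<close> for \<open>p = E / (1 + E)\<close>. Their positivity is
    exactly the two pure privacy bounds, and e > 0 makes the system invertible.\<close>
  define A where "A f = (E * P f - Q f) / (E - 1)" for f
  define B where "B f = (E * Q f - P f) / (E - 1)" for f
  have A: "linear_expectation A"
    unfolding linear_expectation_def
  proof (intro conjI allI impI)
    fix f g :: "'a \<Rightarrow> real" and a b :: real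
    assume fg: "bounded_real_fun f" "bounded_real_fun g"
    show "A (\<lambda>x. a * f x + b * g x) = a * A f + b * A g"
      unfolding A_def linear_expectation_lincomb[OF P fg] linear_expectation_lincomb[OF Q fg]
      by (simp add: algebra_simps add_divide_distrib diff_divide_distrib)
  next
    show "A (\<lambda>_. 1) = 1" using P Q E by (simp add: A_def linear_expectation_def)
  next
    fix f :: "'a \<Rightarrow> real" assume "bounded_real_fun f" "\<forall>x. f x \<ge> 0"
    then show "A f \<ge> 0" using QP E by (simp add: A_def E_def)
  qed
  have B: "linear_expectation B"
    unfolding linear_expectation_def
  proof (intro conjI allI impI)
    fix f g :: "'a \<Rightarrow> real" and a b :: real
    assume fg: "bounded_real_fun f" "bounded_real_fun g"
    show "B (\<lambda>x. a * f x + b * g x) = a * B f + b * B g"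
      unfolding B_def linear_expectation_lincomb[OF P fg] linear_expectation_lincomb[OF Q fg]
      by (simp add: algebra_simps add_divide_distrib diff_divide_distrib)
  next
    show "B (\<lambda>_. 1) = 1" using P Q E by (simp add: B_def linear_expectation_def)
  next
    fix f :: "'a \<Rightarrow> real" assume "bounded_real_fun f" "\<forall>x. f x \<ge> 0"
    then show "B f \<ge> 0" using PQ E by (simp add: B_def E_def)
  qed
  define p where "p = E / (1 + E)"
  have p: "0 < p" "p < 1" "1 - p = 1 / (1 + E)" using E by (auto simp: p_def field_simps)
  have mix: "p * ((E * x - y) / (E - 1)) + (1 - p) * ((E * y - x) / (E - 1)) = x" for x y
  proof -
    have "p * ((E * x - y) / (E - 1)) + (1 - p) * ((E * y - x) / (E - 1))
        = (E * (E * x - y) + (E * y - x)) / ((1 + E) * (E - 1))"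
      unfolding p(3) unfolding p_def times_divide_times_eq add_divide_distrib[symmetric] by simp
    also have "E * (E * x - y) + (E * y - x) = ((1 + E) * (E - 1)) * x"
      by (simp add: algebra_simps)
    finally show ?thesis using E by simp
  qed
  have Pd: "P f = p * A f + (1 - p) * B f" and Qd: "Q f = (1 - p) * A f + p * B f" for f
    using mix[of "P f" "Q f"] mix[of "Q f" "P f"] by (simp_all add: A_def B_def add.commute)
  define g where "g = 1 - 1 / alpha"
  have g: "0 < g" "g < 1" using alpha by (auto simp: g_def field_simps)
  have nn: "A H \<ge> 0" "B H \<ge> 0" using A B H by (auto simp: linear_expectation_def)
  have "P (\<lambda>x. H x powr g) \<le> p * A H powr g + (1 - p) * B H powr g"
    unfolding Pd using p(1,2) linear_expectation_Jensen_powr[OF A H g] linear_expectation_Jensen_powr[OF B H g]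
    by (intro add_mono mult_left_mono) auto
  also have "\<dots> \<le> (p powr alpha * (1 - p) powr (1 - alpha) + (1 - p) powr alpha * p powr (1 - alpha)) powr (1 / alpha)
     * ((1 - p) * A H + p * B H) powr g"
    unfolding g_def using p(1,2) nn alpha by (intro Holder_two_powr) auto
  also have "\<dots> \<le> exp (alpha * (alpha - 1) * e\<^sup>2 / 2) powr (1 / alpha) * ((1 - p) * A H + p * B H) powr g"
    using randomized_response_renyi_le[of e alpha] e alpha
    by (intro mult_right_mono powr_mono2) (auto simp: p_def E_def)
  also have "exp (alpha * (alpha - 1) * e\<^sup>2 / 2) powr (1 / alpha) = exp ((alpha - 1) * e\<^sup>2 / 2)"
    using alpha by (simp add: powr_def)
  finally show ?thesis by (simp add: Qd[symmetric] g_def)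
qed

section \<open>Conversion to approximate differential privacy\<close>

text \<open>The additive term is the maximum over w \<ge> 0 of
  \<open>exp ((alpha - 1) * rho) * w powr g - exp eps * w\<close> with
  \<open>g = 1 - 1 / alpha\<close>.\<close>

lemma Holder_imp_dp:
  fixes u w rho eps alpha :: real
  assumes "alpha > 1" "w \<ge> 0" and u: "u \<le> exp ((alpha - 1) * rho) * w powr (1 - 1 / alpha)"
  shows "u \<le> exp eps * w + exp ((alpha - 1) * (alpha * rho - eps)) / (alpha - 1)
                                   * (1 - 1 / alpha) powr alpha"
proof -
  define g where "g = 1 - 1 / alpha"
  have g: "0 < g" "g < 1" using assms by (auto simp: g_def field_simps)
  \<comment> \<open>The requirement \<open>g * b = exp eps * w\<close> fixes b; then a is fixed by
    asking that \<open>a powr (1 - g) * b powr g\<close> be the given bound on u.\<close>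
  define a where "a = exp (alpha * (alpha - 1) * rho - (alpha - 1) * eps) * g powr (alpha - 1)"
  define b where "b = exp eps * w / g"
  have ga: "alpha * (1 - g) = 1" "(alpha - 1) * (1 - g) = g" "1 - g = 1 / alpha"
    using assms by (auto simp: g_def field_simps)
  have "a powr (1 - g) = exp ((alpha * (alpha - 1) * rho - (alpha - 1) * eps) * (1 - g)) * g powr ((alpha - 1) * (1 - g))"
    unfolding a_def using g by (simp add: powr_mult powr_powr) (simp add: powr_def mult.commute)
  also have "(alpha * (alpha - 1) * rho - (alpha - 1) * eps) * (1 - g) = (alpha * (1 - g)) * ((alpha - 1) * rho) - ((alpha - 1) * (1 - g)) * eps"
    by (simp add: algebra_simps)
  finally have a: "a powr (1 - g) = exp ((alpha - 1) * rho - g * eps) * g powr g"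
    unfolding ga(1,2) by simp
  have b: "b powr g = exp (g * eps) * w powr g / g powr g"
    unfolding b_def using g assms by (simp add: powr_divide powr_mult) (simp add: powr_def mult.commute)
  have "a powr (1 - g) * b powr g = exp ((alpha - 1) * rho) * w powr g"
    unfolding a b using g by (simp add: exp_diff)
  then have "u \<le> (1 - g) * a + g * b"
    using u powr_mult_le_weighted_sum[of g a b] g assms by (simp add: g_def a_def b_def)
  also have "g * b = exp eps * w" using g by (simp add: b_def)
  also have "(1 - g) * a = exp ((alpha - 1) * (alpha * rho - eps)) / (alpha - 1) * g powr alpha"
  proof -
    have "g powr alpha = g * g powr (alpha - 1)" using g by (simp add: powr_diff)
    moreover have "1 - g = g / (alpha - 1)" using assms by (simp add: g_def field_simps)
    moreover have "alpha * (alpha - 1) * rho - (alpha - 1) * eps = (alpha - 1) * (alpha * rho - eps)"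
      by (simp add: algebra_simps)
    ultimately show ?thesis by (simp add: a_def)
  qed
  finally show ?thesis by (simp add: g_def)
qed

section \<open>Sparse vector search and private rounds\<close>

lemma sets_laplace [measurable_cong, simp]: "sets (laplace b) = sets borel"
  by (simp add: laplace_def)

lemma space_laplace [simp]: "space (laplace b) = UNIV"
  by (simp add: laplace_def)

lemma nn_integral_laplace:
  "g \<in> borel_measurable borel \<Longrightarrow>
    (\<integral>\<^sup>+x. g x \<partial>laplace b) = (\<integral>\<^sup>+x. ennreal (exp (- \<bar>x\<bar> / b) / (2 * b)) * g x \<partial>lborel)"
  unfolding laplace_def by (subst nn_integral_density) auto

text \<open>Twice the Laplace density is the exponential density plus its mirror image, except at 0,
  where both contribute; hence the equality almost everywhere.\<close>

lemma prob_space_laplace: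
  assumes "b > 0" shows "prob_space (laplace b)"
proof
  have "(\<integral>\<^sup>+x. ennreal (exponential_density (1 / b) x) \<partial>lborel) = 1"
    using prob_space.emeasure_space_1[OF prob_space_exponential_density, of "1 / b"] assms
    by (simp add: emeasure_density)
  moreover have "(\<integral>\<^sup>+x. ennreal (exponential_density (1 / b) x) \<partial>lborel)
      = (\<integral>\<^sup>+x. ennreal (exponential_density (1 / b) (- x)) \<partial>lborel)"
    using nn_integral_real_affine[of "\<lambda>x. ennreal (exponential_density (1 / b) x)" "-1" 0] by simp
  ultimately have "(\<integral>\<^sup>+x. ennreal (exponential_density (1 / b) x) + ennreal (exponential_density (1 / b) (- x)) \<partial>lborel) = 2"
    by (subst nn_integral_add) auto
  also have "(\<integral>\<^sup>+x. ennreal (exponential_density (1 / b) x) + ennreal (exponential_density (1 / b) (- x)) \<partial>lborel)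
      = (\<integral>\<^sup>+x. 2 * ennreal (exp (- \<bar>x\<bar> / b) / (2 * b)) \<partial>lborel)"
  proof (rule nn_integral_cong_AE)
    have "AE x in lborel. x \<noteq> (0::real)" by (rule AE_lborel_singleton)
    then show "AE x in lborel. ennreal (exponential_density (1 / b) x) + ennreal (exponential_density (1 / b) (- x))
        = 2 * ennreal (exp (- \<bar>x\<bar> / b) / (2 * b))"
    proof eventually_elim
      case (elim x)
      have "2 * ennreal (exp (- \<bar>x\<bar> / b) / (2 * b)) = ennreal (exp (- \<bar>x\<bar> / b) / b)"
        using assms by (subst ennreal_numeral[symmetric], subst ennreal_mult'[symmetric]) auto
      then show ?case using elim assms by (auto simp: exponential_density_def)
    qed
  qed
  also have "\<dots> = 2 * emeasure (laplace b) (space (laplace b))"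
    by (subst nn_integral_cmult) (auto simp: laplace_def emeasure_density)
  finally have "2 * emeasure (laplace b) (space (laplace b)) = 2 * 1" by simp
  then show "emeasure (laplace b) (space (laplace b)) = 1"
    by (subst (asm) ennreal_mult_cancel_left) auto
qed

text \<open>By the triangle inequality, translating the Laplace density by a changes it by a factor
  of at most \<open>exp (\<bar>a\<bar> / b)\<close>.\<close>

lemma nn_integral_laplace_shift:
  assumes [measurable]: "g \<in> borel_measurable borel" and b: "b > 0"
  shows "(\<integral>\<^sup>+x. g x \<partial>laplace b) \<le> ennreal (exp (\<bar>a\<bar> / b)) * (\<integral>\<^sup>+x. g (x + a) \<partial>laplace b)"
proof -
  have "(\<integral>\<^sup>+x. g x \<partial>laplace b) = (\<integral>\<^sup>+x. ennreal (exp (- \<bar>x + a\<bar> / b) / (2 * b)) * g (x + a) \<partial>lborel)"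
    using nn_integral_real_affine[of "\<lambda>x. ennreal (exp (- \<bar>x\<bar> / b) / (2 * b)) * g x" 1 a]
    by (simp add: nn_integral_laplace add.commute)
  also have "\<dots> \<le> (\<integral>\<^sup>+x. ennreal (exp (\<bar>a\<bar> / b)) * (ennreal (exp (- \<bar>x\<bar> / b) / (2 * b)) * g (x + a)) \<partial>lborel)"
  proof (rule nn_integral_mono)
    fix x
    have "- \<bar>x + a\<bar> / b \<le> \<bar>a\<bar> / b + - \<bar>x\<bar> / b"
      using b by (simp add: field_simps)
    then have "exp (- \<bar>x + a\<bar> / b) / (2 * b) \<le> exp (\<bar>a\<bar> / b) * (exp (- \<bar>x\<bar> / b) / (2 * b))"
      using b by (simp add: divide_right_mono flip: exp_add)
    then have "ennreal (exp (- \<bar>x + a\<bar> / b) / (2 * b)) \<le> ennreal (exp (\<bar>a\<bar> / b)) * ennreal (exp (- \<bar>x\<bar> / b) / (2 * b))"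
      using b by (subst ennreal_mult'[symmetric]) (auto intro: ennreal_leI)
    then show "ennreal (exp (- \<bar>x + a\<bar> / b) / (2 * b)) * g (x + a)
       \<le> ennreal (exp (\<bar>a\<bar> / b)) * (ennreal (exp (- \<bar>x\<bar> / b) / (2 * b)) * g (x + a))"
      by (metis mult.assoc mult_right_mono zero_le)
  qed
  also have "\<dots> = ennreal (exp (\<bar>a\<bar> / b)) * (\<integral>\<^sup>+x. g (x + a) \<partial>laplace b)"
    by (simp add: nn_integral_laplace nn_integral_cmult)
  finally show ?thesis .
qed

lemma integrable_laplace_bounded:
  fixes g :: "real \<Rightarrow> real"
  assumes "b > 0" "g \<in> borel_measurable borel" "\<And>x. \<bar>g x\<bar> \<le> B"
  shows "integrable (laplace b) g"
proof -
  interpret prob_space "laplace b" by (rule prob_space_laplace) fact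
  show ?thesis using assms by (intro integrable_const_bound[of _ B]) auto
qed

lemma integral_laplace_shift:
  fixes g :: "real \<Rightarrow> real"
  assumes g[measurable]: "g \<in> borel_measurable borel" and b: "b > 0"
    and g0: "\<And>x. 0 \<le> g x" and B: "\<And>x. \<bar>g x\<bar> \<le> B"
  shows "(\<integral>x. g x \<partial>laplace b) \<le> exp (\<bar>a\<bar> / b) * (\<integral>x. g (x + a) \<partial>laplace b)"
proof -
  have "ennreal (\<integral>x. g x \<partial>laplace b) = (\<integral>\<^sup>+x. ennreal (g x) \<partial>laplace b)"
    using integrable_laplace_bounded[OF b g B] g0 by (simp add: nn_integral_eq_integral)
  also have "\<dots> \<le> ennreal (exp (\<bar>a\<bar> / b)) * (\<integral>\<^sup>+x. ennreal (g (x + a)) \<partial>laplace b)"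
    by (rule nn_integral_laplace_shift) (use b in auto)
  also have "(\<integral>\<^sup>+x. ennreal (g (x + a)) \<partial>laplace b) = ennreal (\<integral>x. g (x + a) \<partial>laplace b)"
    using abs_le_D1[OF B] g0
    by (intro nn_integral_eq_integral integrable_laplace_bounded[OF b, where B=B]) auto
  finally show ?thesis
    by (subst (asm) ennreal_mult'[symmetric]) (auto simp: g0 intro!: mult_nonneg_nonneg)
qed

text \<open>The interval is open because a comparison passes on equality:
  \<open>d + eta \<ge> t\<close> fails exactly when \<open>eta < t - d\<close>.\<close>

definition laplace_below :: "real \<Rightarrow> real \<Rightarrow> real" where
  "laplace_below b x = measure (laplace b) {..<x}"

lemma laplace_below_mono: "b > 0 \<Longrightarrow> x \<le> y \<Longrightarrow> laplace_below b x \<le> laplace_below b y"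
  unfolding laplace_below_def
  by (intro finite_measure.finite_measure_mono prob_space.finite_measure prob_space_laplace) auto

lemma laplace_below_measurable [measurable]: "b > 0 \<Longrightarrow> laplace_below b \<in> borel_measurable borel"
  by (intro borel_measurable_mono) (simp add: mono_def laplace_below_mono)

lemma laplace_below_nonneg: "0 \<le> laplace_below b x"
  by (simp add: laplace_below_def)

lemma laplace_below_le_1: "b > 0 \<Longrightarrow> laplace_below b x \<le> 1"
  unfolding laplace_below_def using prob_space.prob_le_1[OF prob_space_laplace] by auto

lemma laplace_above: "b > 0 \<Longrightarrow> measure (laplace b) {x..} = 1 - laplace_below b x"
  using prob_space.prob_compl[OF prob_space_laplace, of b "{..<x}"]
  by (simp add: laplace_below_def Compl_eq_Diff_UNIV[symmetric])

lemma laplace_above_shift: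
  assumes "b > 0" "a \<ge> 0"
  shows "1 - laplace_below b x \<le> exp (a / b) * (1 - laplace_below b (x + a))"
proof -
  interpret prob_space "laplace b" by (rule prob_space_laplace) fact
  have "(\<integral>y. indicator {x..} y \<partial>laplace b) \<le> exp (\<bar>- a\<bar> / b) * (\<integral>y. indicator {x..} (y + - a) \<partial>laplace b)"
    using assms by (intro integral_laplace_shift[where B=1]) (auto simp: indicator_def)
  also have "(\<lambda>y. indicator {x..} (y + - a)) = (indicator {x + a..} :: real \<Rightarrow> real)"
    by (auto simp: indicator_def)
  finally show ?thesis using assms by (simp flip: laplace_above)
qed

section \<open>One sparse vector search\<close>

text \<open>The public token distribution and the successor map do not depend on the data, so
  neighboring runs share this locale and their searches differ only in the argument d.\<close>

locale token_process =
  fixes v :: nat and sig theta :: real and pub :: "'x \<Rightarrow> nat \<Rightarrow> real"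
    and nxt :: "'x \<Rightarrow> nat \<Rightarrow> 'x"
  assumes sig: "sig > 0" and pub_nonneg: "\<And>x i. pub x i \<ge> 0"
    and pub_sum: "\<And>x. (\<Sum>i<v. pub x i) = 1"
begin

abbreviation "below \<equiv> laplace_below (2 * sig)"

text \<open>Expected payoff of one sparse vector search with d giving the distances, current noisy
threshold t and at most n further tokens. The payoff is G (m, y) with m > 0 if the threshold is
passed in state y with m tokens to go, and G (0, y) if it is never passed.\<close>
primrec svt :: "('x \<Rightarrow> real) \<Rightarrow> (nat \<times> 'x \<Rightarrow> real) \<Rightarrow> nat \<Rightarrow> 'x \<Rightarrow> real \<Rightarrow> real" where
  "svt d G 0 x t = G (0, x)"
| "svt d G (Suc n) x t = (1 - below (t - d x)) * G (Suc n, x)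
     + below (t - d x) * (\<Sum>i<v. pub x i * svt d G n (nxt x i) t)"

lemma below: "0 \<le> below x" "below x \<le> 1" "below \<in> borel_measurable borel"
  using sig by (auto intro: laplace_below_nonneg laplace_below_le_1)

lemma svt_measurable [measurable]: "svt d G n x \<in> borel_measurable borel"
proof (induction n arbitrary: x)
  case 0
  have "svt d G 0 x = (\<lambda>t. G (0, x))" by (rule ext) simp
  then show ?case by simp
next
  case (Suc n)
  note [measurable] = below(3) Suc
  have "svt d G (Suc n) x = (\<lambda>t. (1 - below (t - d x)) * G (Suc n, x)
     + below (t - d x) * (\<Sum>i<v. pub x i * svt d G n (nxt x i) t))" by (rule ext) simp
  then show ?case by simp
qed

lemma svt_lincomb: "svt d (\<lambda>z. a * f z + b * g z) n x t = a * svt d f n x t + b * svt d g n x t"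
proof (induction n arbitrary: x)
  case (Suc n)
  show ?case by (simp add: Suc sum.distrib sum_distrib_left algebra_simps)
qed simp

lemma svt_const: "svt d (\<lambda>z. c) n x t = c"
  by (induction n arbitrary: x) (simp_all add: pub_sum left_diff_distrib flip: sum_distrib_right)

lemma svt_nonneg: "(\<And>z. G z \<ge> 0) \<Longrightarrow> svt d G n x t \<ge> 0"
  by (induction n arbitrary: x)
    (auto intro!: add_nonneg_nonneg mult_nonneg_nonneg sum_nonneg simp: below pub_nonneg)

lemma svt_mono: assumes "\<And>z. f z \<le> g z" shows "svt d f n x t \<le> svt d g n x t"
  using svt_lincomb[of d 1 g "-1" f n x t] svt_nonneg[of "\<lambda>z. 1 * g z + (-1) * f z" d n x t] assms
  by simp

lemma svt_abs_le: assumes "\<And>z. \<bar>G z\<bar> \<le> B" shows "\<bar>svt d G n x t\<bar> \<le> B"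
proof -
  have "G z \<le> B" "- B \<le> G z" for z using assms[of z] by auto
  then show ?thesis
    using svt_mono[of G "\<lambda>_. B" d n x t] svt_mono[of "\<lambda>_. - B" G d n x t] by (auto simp: svt_const)
qed

text \<open>Raising the threshold by del on the right makes every public step at least as likely
  there, so staying below costs nothing. Only passing costs a factor: the argument of the tail moves
  by at most \<open>2 * del\<close> against noise of scale \<open>2 * sig\<close>. A search passes
  at most once, so the factor does not grow with n.\<close>

lemma svt_shift:
  assumes d: "\<And>x. \<bar>d x - d' x\<bar> \<le> del" and G: "\<And>z. G z \<ge> 0"
  shows "svt d G n x t \<le> exp (del / sig) * svt d' G n x (t + del)"
proof (induction n arbitrary: x)
  case 0
  have "del \<ge> 0" using d[of x] by linarith
  \<comment> \<open>Never passing leaves the payoff unchanged, and the factor is at least 1.\<close>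
  then have "exp (del / sig) \<ge> 1" using sig by simp
  then show ?case using mult_right_mono[of 1 "exp (del / sig)" "G (0, x)"] G by simp
next
  case (Suc n)
  let ?F = "below (t - d x)" and ?F' = "below (t + del - d' x)"
  have "t - d x \<le> t + del - d' x" using d[of x] by linarith
  then have F: "?F \<le> ?F'" using sig by (intro laplace_below_mono) auto
  have del: "del \<ge> 0" using d[of x] by linarith
  have "1 - ?F \<le> exp (2 * del / (2 * sig)) * (1 - below (t - d x + 2 * del))"
    using sig del by (intro laplace_above_shift) auto
  also have "\<dots> \<le> exp (del / sig) * (1 - ?F')"
  proof -
    have "?F' \<le> below (t - d x + 2 * del)"
      using sig d[of x] by (intro laplace_below_mono) (auto simp: abs_le_iff)
    then show ?thesis by simp
  qed
  finally have *: "(1 - ?F) * G (Suc n, x) \<le> exp (del / sig) * ((1 - ?F') * G (Suc n, x))"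
    using mult_right_mono[OF _ G] by (metis mult.assoc)
  have "(\<Sum>i<v. pub x i * svt d G n (nxt x i) t)
      \<le> (\<Sum>i<v. pub x i * (exp (del / sig) * svt d' G n (nxt x i) (t + del)))"
    by (intro sum_mono mult_left_mono Suc pub_nonneg)
  then have "?F * (\<Sum>i<v. pub x i * svt d G n (nxt x i) t)
      \<le> ?F' * (\<Sum>i<v. pub x i * (exp (del / sig) * svt d' G n (nxt x i) (t + del)))"
    by (intro mult_mono F) (auto intro!: sum_nonneg mult_nonneg_nonneg pub_nonneg svt_nonneg G simp: below)
  with * show ?case by (simp add: algebra_simps sum_distrib_left)
qed

definition svt_fresh :: "('x \<Rightarrow> real) \<Rightarrow> (nat \<times> 'x \<Rightarrow> real) \<Rightarrow> nat \<Rightarrow> 'x \<Rightarrow> real" where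
  "svt_fresh d G n x = (\<integral>zeta. svt d G n x (theta + zeta) \<partial>laplace sig)"

lemma integrable_svt:
  assumes "bounded_real_fun G" shows "integrable (laplace sig) (\<lambda>zeta. svt d G n x (theta + zeta))"
proof -
  obtain B where "\<And>z. \<bar>G z\<bar> \<le> B" using assms unfolding bounded_real_fun_def by blast
  then show ?thesis using sig svt_abs_le
    by (intro integrable_laplace_bounded[where B=B]) auto
qed

lemma svt_fresh_const: "svt_fresh d (\<lambda>_. c) n x = c"
  unfolding svt_fresh_def svt_const
  using prob_space.prob_space[OF prob_space_laplace[OF sig]] by simp

lemma linear_expectation_svt_fresh: "linear_expectation (\<lambda>G. svt_fresh d G n x)"
  unfolding linear_expectation_def
  by (auto simp: svt_fresh_const)
    (auto simp: svt_fresh_def svt_lincomb integrable_svt intro!: Bochner_Integration.integral_nonneg svt_nonneg)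

lemma svt_fresh_mono:
  "bounded_real_fun f \<Longrightarrow> bounded_real_fun g \<Longrightarrow> (\<And>x. f x \<le> g x) \<Longrightarrow> svt_fresh d f n x \<le> svt_fresh d g n x"
  by (rule linear_expectation_mono[OF linear_expectation_svt_fresh])

text \<open>One factor \<open>exp (del / sig)\<close> pays for passing, another for undoing the
  raised threshold by translating its own Laplace noise by \<open>- del\<close>.\<close>

lemma svt_fresh_pure_dp:
  assumes d: "\<And>x. \<bar>d x - d' x\<bar> \<le> del" and G: "bounded_real_fun G" "\<And>z. G z \<ge> 0"
  shows "svt_fresh d G n x \<le> exp (2 * del / sig) * svt_fresh d' G n x"
proof -
  obtain B where B: "\<And>z. \<bar>G z\<bar> \<le> B" using G unfolding bounded_real_fun_def by blast
  have del: "del \<ge> 0" using d[of x] by linarith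
  have int: "integrable (laplace sig) (\<lambda>zeta. svt d' G n x (theta + zeta + del))"
    using sig svt_abs_le B by (intro integrable_laplace_bounded[where B=B]) auto
  have "svt_fresh d G n x \<le> (\<integral>zeta. exp (del / sig) * svt d' G n x (theta + zeta + del) \<partial>laplace sig)"
    unfolding svt_fresh_def
    by (intro integral_mono integrable_svt svt_shift d G integrable_mult_right int)
  also have "\<dots> = exp (del / sig) * (\<integral>zeta. svt d' G n x (theta + zeta + del) \<partial>laplace sig)"
    by simp
  also have "(\<integral>zeta. svt d' G n x (theta + zeta + del) \<partial>laplace sig)
     \<le> exp (\<bar>- del\<bar> / sig) * (\<integral>zeta. svt d' G n x (theta + (zeta + - del) + del) \<partial>laplace sig)"
    using svt_abs_le[of G B d'] B sig
    by (intro integral_laplace_shift[where B=B]) (auto intro: svt_nonneg G)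
  also have "(\<integral>zeta. svt d' G n x (theta + (zeta + - del) + del) \<partial>laplace sig) = svt_fresh d' G n x"
    by (simp add: svt_fresh_def)
  finally show ?thesis using del
    by (simp add: mult.assoc[symmetric] flip: exp_add add_divide_distrib)
qed

end

text \<open>The successor state depends on the number j of private tokens still to come because the last
private token closes the current example even if it is not the end token.\<close>
locale private_rounds = token_process v sig theta pub nxt
  for v :: nat and sig theta :: real and pub :: "'x \<Rightarrow> nat \<Rightarrow> real" and nxt +
  fixes nxt_priv :: "nat \<Rightarrow> 'x \<Rightarrow> nat \<Rightarrow> 'x" and phi :: "'x \<Rightarrow> real" and psi :: real
  assumes phi: "\<And>x. 0 \<le> phi x" "\<And>x. phi x \<le> 1" and psi: "0 \<le> psi" "psi \<le> 1"
begin

text \<open>Passing with \<open>Suc m'\<close> tokens to go leaves m' after the private token, which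
  itself counts towards the cutoff. With 0 the cutoff came first and \<open>psi\<close> is
  paid.\<close>

definition payoff :: "('x \<Rightarrow> nat \<Rightarrow> real) \<Rightarrow> nat \<Rightarrow> (nat \<Rightarrow> 'x \<Rightarrow> real) \<Rightarrow> nat \<times> 'x \<Rightarrow> real" where
  "payoff priv j U = (\<lambda>(m, y). case m of 0 \<Rightarrow> psi | Suc m' \<Rightarrow> (\<Sum>i<v. priv y i * U m' (nxt_priv j y i)))"

text \<open>A backward value function: the first number counts the private tokens still to come, n
  the tokens until the cutoff. The index handed to \<open>payoff\<close> counts the private tokens
  that remain after the next one.\<close>

primrec rounds :: "('x \<Rightarrow> real) \<Rightarrow> ('x \<Rightarrow> nat \<Rightarrow> real) \<Rightarrow> nat \<Rightarrow> nat \<Rightarrow> 'x \<Rightarrow> real" where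
  "rounds d priv 0 n x = phi x"
| "rounds d priv (Suc j) n x = svt_fresh d (payoff priv j (rounds d priv j)) n x"

lemma payoff_bounds:
  assumes priv: "\<And>x i. priv x i \<ge> 0" "\<And>x. (\<Sum>i<v. priv x i) = 1"
    and U: "\<And>n x. 0 \<le> U n x" "\<And>n x. U n x \<le> 1"
  shows "0 \<le> payoff priv j U z" "payoff priv j U z \<le> 1"
proof -
  obtain m y where z: "z = (m, y)" by force
  have "(\<Sum>i<v. priv y i * U m' (nxt_priv j y i)) \<le> (\<Sum>i<v. priv y i * 1)" for m'
    by (intro sum_mono mult_left_mono priv U)
  then show "0 \<le> payoff priv j U z" "payoff priv j U z \<le> 1"
    using priv U psi by (auto simp: z payoff_def split: nat.split intro!: sum_nonneg)
qed

lemma bounded_real_fun_01: "(\<And>x. 0 \<le> f x) \<Longrightarrow> (\<And>x. f x \<le> 1) \<Longrightarrow> bounded_real_fun f"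
  by (intro bounded_real_funI[of _ 1]) (auto simp: abs_le_iff intro: order_trans[of _ 0])

lemma rounds_bounds:
  assumes priv: "\<And>x i. priv x i \<ge> 0" "\<And>x. (\<Sum>i<v. priv x i) = 1"
  shows "0 \<le> rounds d priv j n x \<and> rounds d priv j n x \<le> 1"
proof (induction j arbitrary: n x)
  case 0 then show ?case by (simp add: phi)
next
  case (Suc j)
  let ?G = "payoff priv j (rounds d priv j)"
  have G: "0 \<le> ?G z" "?G z \<le> 1" for z using payoff_bounds[OF priv] Suc by auto
  have b: "bounded_real_fun ?G" using G by (rule bounded_real_fun_01)
  show ?case
    using svt_fresh_mono[OF bounded_real_fun_const b, of 0 d n x] svt_fresh_mono[OF b bounded_real_fun_const, of 1 d n x] G
    by (simp add: svt_fresh_const)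
qed

text \<open>The induction hypothesis bounds continuation values by \<open>K * U' powr g\<close>.
  Holder's inequality for sums moves g outside the private token and
  \<open>pure_dp_imp_Holder\<close> moves it outside the search; the exponents of the two new
  factors add up to the cost of one round.\<close>

lemma rounds_Holder:
  assumes d: "\<And>x. \<bar>d x - d' x\<bar> \<le> del" and del: "del > 0" and alpha: "alpha > 1"
    and priv: "\<And>x i. priv x i \<ge> 0" "\<And>x. (\<Sum>i<v. priv x i) = 1"
    and priv': "\<And>x i. priv' x i > 0" "\<And>x. (\<Sum>i<v. priv' x i) = 1"
    and renyi: "\<And>x. (\<Sum>i<v. priv x i powr alpha * priv' x i powr (1 - alpha))
       \<le> exp (alpha * (alpha - 1) * eta\<^sup>2 / 2)"
  shows "rounds d priv j n x
    \<le> exp ((alpha - 1) * (real j * (eta\<^sup>2 / 2 + 2 * (del / sig)\<^sup>2)))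
        * rounds d' priv' j n x powr (1 - 1 / alpha)"
proof (induction j arbitrary: n x)
  case 0
  \<comment> \<open>On [0,1], lowering the exponent from 1 to \<open>1 - 1 / alpha\<close> can only
    increase a number.\<close>
  have "phi x \<le> phi x powr (1 - 1 / alpha)"
  proof (cases "phi x = 0")
    case False
    then have "phi x powr 1 \<le> phi x powr (1 - 1 / alpha)"
      using phi[of x] alpha by (intro powr_mono') auto
    then show ?thesis using phi[of x] by simp
  qed simp
  then show ?case by simp
next
  case (Suc j)
  define g where "g = 1 - 1 / alpha"
  have g: "0 < g" "g < 1" using alpha by (auto simp: g_def field_simps)
  define K where "K = exp ((alpha - 1) * (real j * (eta\<^sup>2 / 2 + 2 * (del / sig)\<^sup>2)))"
  define K2 where "K2 = exp ((alpha - 1) * eta\<^sup>2 / 2)"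
  have K: "K \<ge> 1" "K2 \<ge> 1" using alpha by (auto simp: K_def K2_def intro!: mult_nonneg_nonneg)
  define U where "U = rounds d priv j"
  define U' where "U' = rounds d' priv' j"
  have priv'0: "priv' x i \<ge> 0" for x i using priv'(1) less_imp_le by blast
  have U: "0 \<le> U n x" "U n x \<le> 1" for n x using rounds_bounds[OF priv] by (auto simp: U_def)
  have U': "0 \<le> U' n x" "U' n x \<le> 1" for n x using rounds_bounds[OF priv'0 priv'(2)] by (auto simp: U'_def)
  define G where "G = payoff priv j U"
  define G' where "G' = payoff priv' j U'"
  have G: "0 \<le> G z" "G z \<le> 1" for z unfolding G_def by (intro payoff_bounds priv U)+
  have G': "0 \<le> G' z" "G' z \<le> 1" for z unfolding G'_def by (intro payoff_bounds priv'0 priv' U')+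
  have GG: "G z \<le> K * K2 * G' z powr g" for z
  proof -
    obtain m y where z: "z = (m, y)" by force
    show ?thesis
    proof (cases m)
      case 0
      \<comment> \<open>At the cutoff both runs are paid the same \<open>psi\<close>; the factors K
        and K2 are at least 1, so the common bound covers this case.\<close>
      have "psi \<le> psi powr g"
      proof (cases "psi = 0")
        case False
        then have "psi powr 1 \<le> psi powr g" using psi g by (intro powr_mono') auto
        then show ?thesis using psi by simp
      qed simp
      also have "\<dots> \<le> K * K2 * psi powr g"
        using mult_right_mono[of 1 "K * K2" "psi powr g"] mult_mono[of 1 K 1 K2] K by simp
      finally show ?thesis by (simp add: G_def G'_def payoff_def z 0)
    next
      case (Suc m')
      let ?u = "\<lambda>i. U m' (nxt_priv j y i)" and ?u' = "\<lambda>i. U' m' (nxt_priv j y i)"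
      have "(\<Sum>i<v. priv y i * ?u i) \<le> (\<Sum>i<v. priv y i * (K * ?u' i powr g))"
        using Suc.IH unfolding U_def U'_def K_def g_def by (intro sum_mono mult_left_mono priv) auto
      also have "\<dots> = K * (\<Sum>i<v. priv y i * ?u' i powr g)"
        by (simp add: sum_distrib_left algebra_simps)
      also have "(\<Sum>i<v. priv y i * ?u' i powr g) \<le>
         (\<Sum>i<v. priv y i powr alpha * priv' y i powr (1 - alpha)) powr (1 / alpha) * (\<Sum>i<v. priv' y i * ?u' i) powr g"
        unfolding g_def using alpha priv priv' U' by (intro Holder_sum_powr) auto
      also have "\<dots> \<le> exp (alpha * (alpha - 1) * eta\<^sup>2 / 2) powr (1 / alpha) * (\<Sum>i<v. priv' y i * ?u' i) powr g"
        using alpha renyi by (intro mult_right_mono powr_mono2) (auto intro!: sum_nonneg)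
      also have "exp (alpha * (alpha - 1) * eta\<^sup>2 / 2) powr (1 / alpha) = K2"
        using alpha by (simp add: powr_def K2_def)
      finally show ?thesis using K by (simp add: G_def G'_def payoff_def z Suc mult.assoc)
    qed
  qed
  have bG: "bounded_real_fun G" "bounded_real_fun G'" using G G' by (auto intro: bounded_real_fun_01)
  have bG'g: "bounded_real_fun (\<lambda>z. G' z powr g)" using bG G' g by (intro bounded_real_fun_powr) auto
  have "rounds d priv (Suc j) n x \<le> svt_fresh d (\<lambda>z. (K * K2) * G' z powr g + 0 * 0) n x"
    unfolding rounds.simps G_def[symmetric] U_def[symmetric]
    using GG by (intro svt_fresh_mono bG bounded_real_fun_lincomb bG'g bounded_real_fun_const) auto
  also have "\<dots> = K * K2 * svt_fresh d (\<lambda>z. G' z powr g) n x"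
    by (rule trans[OF linear_expectation_lincomb[OF linear_expectation_svt_fresh bG'g bounded_real_fun_const]]) simp
  \<comment> \<open>With \<open>e = 2 * del / sig\<close> the term \<open>e\<^sup>2 / 2\<close>
    equals \<open>2 * (del / sig)\<^sup>2\<close>.\<close>
  also have "svt_fresh d (\<lambda>z. G' z powr g) n x \<le> exp ((alpha - 1) * (2 * del / sig)\<^sup>2 / 2) * svt_fresh d' G' n x powr g"
    unfolding g_def
  proof (rule pure_dp_imp_Holder[OF linear_expectation_svt_fresh linear_expectation_svt_fresh])
    fix f :: "nat \<times> 'x \<Rightarrow> real" assume f: "bounded_real_fun f" "\<And>x. f x \<ge> 0"
    have d': "\<bar>d' x - d x\<bar> \<le> del" for x using d[of x] by (simp add: abs_minus_commute)
    show "svt_fresh d f n x \<le> exp (2 * del / sig) * svt_fresh d' f n x"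
      by (rule svt_fresh_pure_dp[OF d f])
    show "svt_fresh d' f n x \<le> exp (2 * del / sig) * svt_fresh d f n x"
      by (rule svt_fresh_pure_dp[OF d' f])
  qed (use bG G' del sig alpha in auto)
  finally have "rounds d priv (Suc j) n x
    \<le> (K * K2 * exp ((alpha - 1) * (2 * del / sig)\<^sup>2 / 2)) * rounds d' priv' (Suc j) n x powr g"
    using K by (simp add: G'_def U'_def mult.assoc)
  also have "K * K2 * exp ((alpha - 1) * (2 * del / sig)\<^sup>2 / 2)
    = exp ((alpha - 1) * (real (Suc j) * (eta\<^sup>2 / 2 + 2 * (del / sig)\<^sup>2)))"
  proof -
    have "(2 * del / sig)\<^sup>2 = 4 * (del / sig)\<^sup>2" by (simp add: power2_eq_square)
    then show ?thesis
      unfolding K_def K2_def exp_add[symmetric] by (simp add: field_simps del: power_divide)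
  qed
  finally show ?case unfolding g_def .
qed

end

section \<open>The generation process of a batch\<close>

lemma sets_uniform01 [measurable_cong, simp]: "sets uniform01 = sets borel"
  by (simp add: uniform01_def)

lemma space_uniform01 [simp]: "space uniform01 = UNIV"
  by (simp add: uniform01_def)

lemma prob_space_uniform01: "prob_space uniform01"
  unfolding uniform01_def by (intro prob_space_uniform_measure) auto

lemma sample_tok_measurable [measurable]: "sample_tok v p \<in> borel \<rightarrow>\<^sub>M count_space UNIV"
  unfolding sample_tok_def by measurable

text \<open>On [0,1) the preimage of i is the half-open interval between consecutive partial sums,
  of length \<open>p i\<close>. Within [0,1] the fallback branch of \<open>sample_tok\<close> is
  taken only at u = 1, a null set.\<close>

lemma nn_integral_sample_tok:
  fixes h :: "nat \<Rightarrow> ennreal"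
  assumes p: "\<And>i. i < v \<Longrightarrow> p i \<ge> 0" and p1: "(\<Sum>i<v. p i) = 1"
  shows "(\<integral>\<^sup>+u. h (sample_tok v p u) \<partial>uniform01) = (\<Sum>i<v. ennreal (p i) * h i)"
proof -
  have v: "v > 0" using p1 by (cases v) auto
  have lt: "sample_tok v p u < v" for u
  proof (cases "\<exists>j<v. u < (\<Sum>i\<le>j. p i)")
    case True
    then have "(LEAST j. j < v \<and> u < (\<Sum>i\<le>j. p i)) < v" by (metis (mono_tags, lifting) LeastI_ex)
    with True show ?thesis by (simp add: sample_tok_def)
  qed (use v in \<open>auto simp: sample_tok_def\<close>)
  have mono: "(\<Sum>i<a. p i) \<le> (\<Sum>i<b. p i)" if "a \<le> b" "b \<le> v" for a b
    using that p by (intro sum_mono2) auto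
  have iff: "sample_tok v p u = i \<longleftrightarrow> u \<in> {(\<Sum>j<i. p j)..<(\<Sum>j<Suc i. p j)}"
    if "0 \<le> u" "u < 1" "i < v" for u i
  proof -
    have S: "{..j} = {..<Suc j}" for j :: nat by auto
    have ex: "\<exists>j<v. u < (\<Sum>i<Suc j. p i)"
      using v p1 that by (intro exI[of _ "v - 1"]) auto
    define L where "L = (LEAST j. j < v \<and> u < (\<Sum>i<Suc j. p i))"
    have eq: "sample_tok v p u = L" unfolding sample_tok_def S L_def using ex by simp
    have L: "L < v \<and> u < (\<Sum>i<Suc L. p i)" unfolding L_def using ex by (rule LeastI_ex)
    have L': "\<not> (j < v \<and> u < (\<Sum>i<Suc j. p i))" if "j < L" for j
      using that unfolding L_def by (rule not_less_Least)
    have low: "(\<Sum>j<L. p j) \<le> u"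
    proof (cases L)
      case (Suc j)
      then show ?thesis using L'[of j] L by auto
    qed (use that in simp)
    show ?thesis
    proof
      assume "sample_tok v p u = i"
      then show "u \<in> {(\<Sum>j<i. p j)..<(\<Sum>j<Suc i. p j)}" using L low eq by auto
    next
      assume u: "u \<in> {(\<Sum>j<i. p j)..<(\<Sum>j<Suc i. p j)}"
      have "\<not> i < L" using L'[of i] u that by auto
      moreover have "\<not> L < i" using mono[of "Suc L" i] u L that by auto
      ultimately show "sample_tok v p u = i" using eq by simp
    qed
  qed
  have em: "emeasure uniform01 {u. sample_tok v p u = i} = ennreal (p i)" if i: "i < v" for i
  proof -
    have [measurable]: "{u. sample_tok v p u = i} \<in> sets borel"
      using measurable_sets[OF sample_tok_measurable, of "{i}" v p] by (simp add: vimage_def)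
    have "emeasure uniform01 {u. sample_tok v p u = i} = emeasure lborel ({0..1} \<inter> {u. sample_tok v p u = i})"
      unfolding uniform01_def by (subst emeasure_uniform_measure) (auto simp: divide_ennreal_def)
    also have "\<dots> = emeasure lborel {(\<Sum>j<i. p j)..<(\<Sum>j<Suc i. p j)}"
    proof (rule emeasure_eq_AE)
      have "AE u in lborel. u \<noteq> (1::real)" by (rule AE_lborel_singleton)
      then show "AE u in lborel. (u \<in> {0..1} \<inter> {u. sample_tok v p u = i}) \<longleftrightarrow> (u \<in> {(\<Sum>j<i. p j)..<(\<Sum>j<Suc i. p j)})"
      proof eventually_elim
        case (elim u)
        have "(\<Sum>j<Suc i. p j) \<le> 1" "0 \<le> (\<Sum>j<i. p j)" using mono[of "Suc i" v] mono[of 0 i] p1 i by auto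
        then show ?case using iff[of u i] i elim by auto
      qed
    qed auto
    also have "\<dots> = ennreal (p i)" using p[OF i] by (subst emeasure_lborel_Ico) auto
    finally show ?thesis .
  qed
  have "(\<integral>\<^sup>+u. h (sample_tok v p u) \<partial>uniform01)
     = (\<integral>\<^sup>+u. (\<Sum>i<v. h i * indicator {u. sample_tok v p u = i} u) \<partial>uniform01)"
  proof (rule nn_integral_cong)
    fix u
    have "(\<Sum>i<v. h i * indicator {u. sample_tok v p u = i} u) = (\<Sum>i<v. if i = sample_tok v p u then h i else 0)"
      by (intro sum.cong) (auto simp: indicator_def)
    then show "h (sample_tok v p u) = (\<Sum>i<v. h i * indicator {u. sample_tok v p u = i} u)"
      using lt by (simp add: sum.delta)
  qed
  also have "\<dots> = (\<Sum>i<v. h i * emeasure uniform01 {u. sample_tok v p u = i})"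
  proof -
    have "{u. sample_tok v p u = i} \<in> sets uniform01" for i
      using measurable_sets[OF sample_tok_measurable, of "{i}" v p] by (simp add: vimage_def)
    then show ?thesis by (subst nn_integral_sum) (auto simp: nn_integral_cmult_indicator)
  qed
  also have "\<dots> = (\<Sum>i<v. ennreal (p i) * h i)"
    by (intro sum.cong) (auto simp: em mult.commute)
  finally show ?thesis .
qed

section \<open>Measurability of random states\<close>

type_synonym dstate = "nat list set \<times> nat list \<times> nat \<times> bool"

text \<open>The threshold is the only continuous component of a state; the others range over a countable
set because the set of produced examples stays finite.\<close>
definition dpart :: "gen_state \<Rightarrow> dstate" where
  "dpart st = (outs st, cur st, cnt st, fin st)"

definition mk_state :: "dstate \<Rightarrow> real \<Rightarrow> gen_state" where
  "mk_state = (\<lambda>(O', x, t, b) th. \<lparr>outs = O', cur = x, cnt = t, thr = th, fin = b\<rparr>)"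

definition dstates :: "dstate set" where
  "dstates = {O'. finite O'} \<times> UNIV"

lemma mk_state_dpart [simp]: "mk_state (dpart st) (thr st) = st"
  by (simp add: mk_state_def dpart_def)

lemma countable_dstates: "countable dstates"
  unfolding dstates_def by (intro countable_SIGMA countable_Collect_finite) auto

text \<open>The record type carries no sigma-algebra, so measurability is stated for the countable
  part and the threshold separately. The codomain \<open>dstates\<close> also records that only
  finitely many examples have been produced.\<close>

definition measurable_state :: "'a measure \<Rightarrow> ('a \<Rightarrow> gen_state) \<Rightarrow> bool" where
  "measurable_state M A \<longleftrightarrow>
     (\<lambda>x. dpart (A x)) \<in> M \<rightarrow>\<^sub>M count_space dstates \<and> (\<lambda>x. thr (A x)) \<in> borel_measurable M"

locale batch_process =
  fixes logits :: "nat list \<Rightarrow> nat \<Rightarrow> real" and v eos :: nat and ppub :: "nat list"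
    and s :: real and r :: nat and c tau taupub theta sig :: real
  assumes v: "v > 0" and s: "s > 0" and r: "r > 0" and c: "c > 0" and tau: "tau > 0"
    and taupub: "taupub > 0" and sig': "sig > 0"
begin

abbreviation "bstep \<equiv> batch_step logits v eos ppub s r c tau taupub theta"
abbreviation "brun \<equiv> batch_run logits v eos ppub s r c tau taupub theta"
abbreviation "bout \<equiv> batch_out logits v eos ppub s r c tau taupub theta"
abbreviation "rnd \<equiv> laplace (2 * sig) \<Otimes>\<^sub>M (laplace sig \<Otimes>\<^sub>M uniform01)"

text \<open>An arbitrary starting state allows the first noise triple to be split off, as
  integration over \<open>stream_space\<close> requires, while \<open>batch_run\<close> always
  starts from the initial state.\<close>

primrec run_from :: "nat list set \<Rightarrow> gen_state \<Rightarrow> (real \<times> real \<times> real) stream \<Rightarrow> nat \<Rightarrow> gen_state" where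
  "run_from S st \<omega> 0 = st"
| "run_from S st \<omega> (Suc n) = bstep S (\<omega> !! n) (run_from S st \<omega> n)"

abbreviation "st0 th \<equiv> \<lparr>outs = {}, cur = [], cnt = 0, thr = theta + th, fin = False\<rparr>"

lemma brun_eq: "brun S th0 \<omega> n = run_from S (st0 th0) \<omega> n"
  by (induction n) auto

lemma run_from_SCons: "run_from S st (z ## \<omega>) (Suc n) = run_from S (bstep S z st) \<omega> n"
  by (induction n) auto

text \<open>The abstract state becomes the pair of produced examples and current example. The
  produced ones influence no sampling; they are carried along because the final payoff depends on
  them.\<close>

definition dS :: "nat list set \<Rightarrow> nat list set \<times> nat list \<Rightarrow> real" where
  "dS S = (\<lambda>(O', x). dist_d v s ((\<lambda>p. logits (p @ x)) ` S) (logits (ppub @ x)))"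

definition pub :: "nat list set \<times> nat list \<Rightarrow> nat \<Rightarrow> real" where
  "pub = (\<lambda>(O', x). softmax v (\<lambda>i. logits (ppub @ x) i / taupub))"

definition priv :: "nat list set \<Rightarrow> nat list set \<times> nat list \<Rightarrow> nat \<Rightarrow> real" where
  "priv S = (\<lambda>(O', x). softmax v (\<lambda>i. (\<Sum>z\<in>(\<lambda>p. logits (p @ x)) ` S. clip v c z i) / s / tau))"

definition nxt :: "nat list set \<times> nat list \<Rightarrow> nat \<Rightarrow> nat list set \<times> nat list" where
  "nxt = (\<lambda>(O', x) i. if i = eos then (insert (x @ [i]) O', []) else (O', x @ [i]))"

definition nxt_priv :: "nat \<Rightarrow> nat list set \<times> nat list \<Rightarrow> nat \<Rightarrow> nat list set \<times> nat list" where
  "nxt_priv j = (if j = 0 then (\<lambda>(O', x) i. (insert (x @ [i]) O', [])) else nxt)"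

lemma bstep_fin: "fin st \<Longrightarrow> bstep S z st = st"
  by (simp add: batch_step_def split: prod.split)

text \<open>\<open>nxt_priv\<close> only distinguishes whether its index is 0, so 1 stands for every
  positive number of remaining private tokens.\<close>

lemma bstep_eq:
  assumes "\<not> fin st"
  shows "bstep S (eta, zeta, u) st =
    (let x = (outs st, cur st) in
      if dS S x + eta \<ge> thr st then
        (let y = nxt_priv (if Suc (cnt st) = r then 0 else 1) x (sample_tok v (priv S x) u) in
          \<lparr>outs = fst y, cur = snd y, cnt = Suc (cnt st), thr = theta + zeta, fin = (Suc (cnt st) = r)\<rparr>)
      else (let y = nxt x (sample_tok v (pub x) u) in
          \<lparr>outs = fst y, cur = snd y, cnt = cnt st, thr = thr st, fin = False\<rparr>))"
  using assms unfolding batch_step_def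
  by (cases st) (auto simp: dS_def priv_def pub_def nxt_def nxt_priv_def Let_def)

lemma finite_nxt: "finite (fst x) \<Longrightarrow> finite (fst (nxt x i))" "finite (fst x) \<Longrightarrow> finite (fst (nxt_priv j x i))"
  by (auto simp: nxt_def nxt_priv_def split: prod.split)

text \<open>The discrete part takes countably many values, so it can be frozen and only the
  threshold remains to be treated.\<close>

lemma measurable_state_compose:
  assumes A: "measurable_state M A"
    and F: "\<And>\<delta>. \<delta> \<in> dstates \<Longrightarrow> (\<lambda>x. F x (mk_state \<delta> (thr (A x)))) \<in> M \<rightarrow>\<^sub>M N"
  shows "(\<lambda>x. F x (A x)) \<in> M \<rightarrow>\<^sub>M N"
proof -
  have "(\<lambda>x. F x (mk_state (dpart (A x)) (thr (A x)))) \<in> M \<rightarrow>\<^sub>M N"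
    by (rule measurable_compose_countable'[OF F _ countable_dstates])
      (use A in \<open>auto simp: measurable_state_def\<close>)
  then show ?thesis by simp
qed

lemma measurable_state_step:
  assumes A: "measurable_state M A" and R: "R \<in> M \<rightarrow>\<^sub>M rnd"
  shows "measurable_state M (\<lambda>x. bstep S (R x) (A x))"
proof -
  have [measurable]: "(\<lambda>x. thr (A x)) \<in> borel_measurable M" using A by (simp add: measurable_state_def)
  have "sets rnd = sets (borel \<Otimes>\<^sub>M (borel \<Otimes>\<^sub>M borel))"
    by (intro sets_pair_measure_cong) auto
  then have [measurable]: "R \<in> M \<rightarrow>\<^sub>M borel \<Otimes>\<^sub>M (borel \<Otimes>\<^sub>M borel)"
    using R measurable_cong_sets[OF refl] by blast
  have [measurable]: "(\<lambda>x. fst (R x)) \<in> borel_measurable M" "(\<lambda>x. fst (snd (R x))) \<in> borel_measurable M"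
      "(\<lambda>x. snd (snd (R x))) \<in> borel_measurable M" by measurable
  have disc: "(\<lambda>x. dpart (bstep S (R x) (mk_state \<delta> (thr (A x))))) \<in> M \<rightarrow>\<^sub>M count_space dstates"
    and cont: "(\<lambda>x. thr (bstep S (R x) (mk_state \<delta> (thr (A x))))) \<in> borel_measurable M"
    if \<delta>: "\<delta> \<in> dstates" for \<delta>
  proof -
    obtain O' xx t b where d: "\<delta> = (O', xx, t, b)" by (metis prod_cases4)
    have O': "finite O'" using \<delta> by (simp add: dstates_def d)
    let ?x = "(O', xx)"
    \<comment> \<open>Discrete successors as functions of the sampled token: \<open>h1\<close> for a
      private step, \<open>h2\<close> for a public one.\<close>
    define h1 where "h1 i = (let y = nxt_priv (if Suc t = r then 0 else 1) ?x i in (fst y, snd y, Suc t, Suc t = r))" for i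
    define h2 where "h2 i = (let y = nxt ?x i in (fst y, snd y, t, False))" for i
    have h: "h1 i \<in> dstates" "h2 i \<in> dstates" for i
      using finite_nxt[of ?x] O' by (auto simp: h1_def h2_def dstates_def Let_def)
    have h1[measurable]: "h1 \<in> count_space UNIV \<rightarrow>\<^sub>M count_space dstates" and
      h2[measurable]: "h2 \<in> count_space UNIV \<rightarrow>\<^sub>M count_space dstates" using h by auto
    have eq: "dpart (bstep S (R x) (mk_state \<delta> (thr (A x)))) =
       (if b then \<delta> else if dS S ?x + fst (R x) \<ge> thr (A x) then h1 (sample_tok v (priv S ?x) (snd (snd (R x))))
        else h2 (sample_tok v (pub ?x) (snd (snd (R x)))))"
      "thr (bstep S (R x) (mk_state \<delta> (thr (A x)))) =
       (if b then thr (A x) else if dS S ?x + fst (R x) \<ge> thr (A x) then theta + fst (snd (R x)) else thr (A x))" for x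
      by (cases "R x"; cases b; simp add: d mk_state_def dpart_def bstep_fin bstep_eq h1_def h2_def Let_def)+
    show "(\<lambda>x. dpart (bstep S (R x) (mk_state \<delta> (thr (A x))))) \<in> M \<rightarrow>\<^sub>M count_space dstates"
      unfolding eq using \<delta> by (cases b) (simp, measurable)
    show "(\<lambda>x. thr (bstep S (R x) (mk_state \<delta> (thr (A x))))) \<in> borel_measurable M"
      unfolding eq by (cases b) (simp, measurable)
  qed
  show ?thesis unfolding measurable_state_def
    using measurable_state_compose[OF A, of "\<lambda>x st. dpart (bstep S (R x) st)", OF disc]
      measurable_state_compose[OF A, of "\<lambda>x st. thr (bstep S (R x) st)", OF cont] by simp
qed

lemma measurable_state_run_from:
  assumes A: "measurable_state M A" and R[measurable]: "R \<in> M \<rightarrow>\<^sub>M stream_space rnd"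
  shows "measurable_state M (\<lambda>x. run_from S (A x) (R x) n)"
proof (induction n)
  case (Suc n)
  have "(\<lambda>x. R x !! n) \<in> M \<rightarrow>\<^sub>M rnd" by measurable
  from measurable_state_step[OF Suc this] show ?case by simp
qed (simp add: A)

lemma measurable_state_dpart:
  assumes "measurable_state M A"
  shows "(\<lambda>x. f (dpart (A x))) \<in> M \<rightarrow>\<^sub>M count_space UNIV"
proof -
  have "(\<lambda>x. dpart (A x)) \<in> M \<rightarrow>\<^sub>M count_space dstates" using assms by (simp add: measurable_state_def)
  moreover have "f \<in> count_space dstates \<rightarrow>\<^sub>M count_space UNIV" by simp
  ultimately show ?thesis by (rule measurable_compose)
qed

end

section \<open>Expected payoff of truncated runs\<close>

lemma nn_integral_laplace_threshold:
  assumes "b > 0"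
  shows "(\<integral>\<^sup>+y. (if x + y \<ge> t then p else q) \<partial>laplace b)
    = ennreal (1 - laplace_below b (t - x)) * p + ennreal (laplace_below b (t - x)) * q"
proof -
  interpret prob_space "laplace b" by (rule prob_space_laplace) fact
  have "(\<integral>\<^sup>+y. (if x + y \<ge> t then p else q) \<partial>laplace b)
     = (\<integral>\<^sup>+y. p * indicator {t - x..} y + q * indicator {..<t - x} y \<partial>laplace b)"
    by (intro nn_integral_cong) (auto simp: indicator_def)
  also have "\<dots> = p * emeasure (laplace b) {t - x..} + q * emeasure (laplace b) {..<t - x}"
    by (subst nn_integral_add) (auto simp: nn_integral_cmult_indicator)
  finally show ?thesis
    using assms by (simp add: emeasure_eq_measure laplace_above laplace_below_def[symmetric] mult.commute)
qed

lemma nn_integral_triple: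
  assumes "sigma_finite_measure M2" "sigma_finite_measure M3"
    and f[measurable]: "f \<in> borel_measurable (M1 \<Otimes>\<^sub>M (M2 \<Otimes>\<^sub>M M3))"
  shows "(\<integral>\<^sup>+z. f z \<partial>(M1 \<Otimes>\<^sub>M (M2 \<Otimes>\<^sub>M M3))) = (\<integral>\<^sup>+x. \<integral>\<^sup>+y. \<integral>\<^sup>+w. f (x, y, w) \<partial>M3 \<partial>M2 \<partial>M1)"
proof -
  interpret M2: sigma_finite_measure M2 by fact
  interpret M3: sigma_finite_measure M3 by fact
  interpret P: pair_sigma_finite M2 M3 ..
  have "(\<integral>\<^sup>+z. f z \<partial>(M1 \<Otimes>\<^sub>M (M2 \<Otimes>\<^sub>M M3))) = (\<integral>\<^sup>+x. \<integral>\<^sup>+y. f (x, y) \<partial>(M2 \<Otimes>\<^sub>M M3) \<partial>M1)"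
    by (rule P.nn_integral_fst[symmetric]) fact
  also have "\<dots> = (\<integral>\<^sup>+x. \<integral>\<^sup>+y. \<integral>\<^sup>+w. f (x, y, w) \<partial>M3 \<partial>M2 \<partial>M1)"
    by (intro nn_integral_cong M3.nn_integral_fst[symmetric]) measurable
  finally show ?thesis .
qed

sublocale batch_process \<subseteq> tp: token_process v sig theta pub nxt
  using v sig' by unfold_locales (auto simp: pub_def sum_softmax less_imp_le[OF softmax_pos] split: prod.split)

context batch_process begin

lemma prob_space_rnd: "prob_space rnd"
  using sig' by (intro prob_space_pair prob_space_laplace prob_space_uniform01) auto

lemma prob_space_batch_space: "prob_space (batch_space sig)"
  unfolding batch_space_def using sig'
  by (intro prob_space_pair prob_space_laplace prob_space.prob_space_stream_space prob_space_rnd)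

lemma sets_rnd: "sets rnd = sets (borel \<Otimes>\<^sub>M (borel \<Otimes>\<^sub>M borel))"
  by (intro sets_pair_measure_cong) auto

lemma priv_pos: "priv S x i > 0"
  using v by (auto simp: priv_def softmax_pos split: prod.split)

lemma priv_sum: "(\<Sum>i<v. priv S x i) = 1"
  using v by (auto simp: priv_def sum_softmax split: prod.split)

end

text \<open>The event is a parameter because, for the whole algorithm, it depends on the noise of
  the other batches: it then consists of the outcomes of the differing batch that complete their
  outputs to a result in the given event.\<close>

locale batch_payoff = batch_process +
  fixes E :: "nat list set option set"
begin

definition phi :: "nat list set \<times> nat list \<Rightarrow> real" where
  "phi x = indicator E (Some (fst x))"

definition psi :: real where "psi = indicator E None"

text \<open>An unfinished run is scored as if it never terminated. The error disappears as the
  cutoff tends to infinity.\<close>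

definition pay :: "gen_state \<Rightarrow> real" where
  "pay st = (if fin st then phi (outs st, cur st) else psi)"

sublocale pr: private_rounds v sig theta pub nxt nxt_priv phi psi
  by unfold_locales (auto simp: phi_def psi_def)

abbreviation "U S \<equiv> pr.rounds (dS S) (priv S)"
abbreviation "G S j \<equiv> pr.payoff (priv S) j (U S j)"

lemma U_bounds: "0 \<le> U S j n x" "U S j n x \<le> 1"
  using pr.rounds_bounds[OF less_imp_le[OF priv_pos] priv_sum] by auto

lemma G_bounds: "0 \<le> G S j z" "G S j z \<le> 1"
  using pr.payoff_bounds[OF less_imp_le[OF priv_pos] priv_sum U_bounds] by auto

lemma nn_integral_svt:
  "(\<integral>\<^sup>+zeta. ennreal (tp.svt (dS S) (G S j) n x (theta + zeta)) \<partial>laplace sig) = ennreal (U S (Suc j) n x)"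
proof -
  have "bounded_real_fun (G S j)" using G_bounds by (rule pr.bounded_real_fun_01)
  from tp.integrable_svt[OF this] show ?thesis
    by (simp add: nn_integral_eq_integral tp.svt_fresh_def tp.svt_nonneg G_bounds)
qed

lemma measurable_state_const: "finite (outs st) \<Longrightarrow> measurable_state M (\<lambda>x. st)"
  by (auto simp: measurable_state_def dpart_def dstates_def)

lemma pay_measurable:
  assumes "measurable_state M A" shows "(\<lambda>x. ennreal (pay (A x))) \<in> borel_measurable M"
proof -
  define h where "h = (\<lambda>(O', x, t :: nat, b). ennreal (if b then phi (O', x) else psi))"
  have "(\<lambda>x. h (dpart (A x))) \<in> M \<rightarrow>\<^sub>M count_space UNIV" by (rule measurable_state_dpart[OF assms])
  then have "(\<lambda>x. h (dpart (A x))) \<in> borel_measurable M"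
    by (rule measurable_compose) simp
  then show ?thesis by (simp add: h_def dpart_def pay_def)
qed

lemma run_from_fin: "fin st \<Longrightarrow> run_from S st \<omega> n = st"
  by (induction n) (auto simp: bstep_fin)

text \<open>First-step analysis: one noise triple is integrated out and the rest of the stream
  restarts from the new state. In the premise on \<open>cnt st\<close>, j counts the private tokens
  that remain after the next one.\<close>

lemma nn_integral_run_from:
  assumes "finite (outs st)" "\<not> fin st" "cnt st + Suc j = r"
  shows "(\<integral>\<^sup>+\<omega>. ennreal (pay (run_from S st \<omega> n)) \<partial>stream_space rnd)
    = ennreal (tp.svt (dS S) (G S j) n (outs st, cur st) (thr st))"
  using assms
proof (induction n arbitrary: st j)
  interpret R: prob_space rnd by (rule prob_space_rnd)
  interpret RS: prob_space "stream_space rnd" by (rule R.prob_space_stream_space)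
  case 0
  then show ?case by (simp add: pay_def pr.payoff_def RS.emeasure_space_1)
next
  interpret R: prob_space rnd by (rule prob_space_rnd)
  interpret RS: prob_space "stream_space rnd" by (rule R.prob_space_stream_space)
  interpret L: prob_space "laplace sig" by (rule prob_space_laplace) (rule sig')
  interpret U1: prob_space uniform01 by (rule prob_space_uniform01)
  case (Suc n)
  let ?x = "(outs st, cur st)" and ?t = "thr st"
  \<comment> \<open>Continuation values given the first noise triple: A after passing, with a fresh
    threshold; B after a public token, with the old threshold.\<close>
  define A where "A zeta i = ennreal (if j = 0 then U S 0 n (nxt_priv j ?x i)
     else tp.svt (dS S) (G S (j - 1)) n (nxt_priv j ?x i) (theta + zeta))" for zeta i
  define B where "B i = ennreal (tp.svt (dS S) (G S j) n (nxt ?x i) ?t)" for i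
  have A_meas[measurable]: "(\<lambda>zeta. A zeta i) \<in> borel_measurable borel" for i
    unfolding A_def by measurable
  \<comment> \<open>Averaging over the fresh threshold turns the value of a search into
    \<open>U\<close>; this is where refreshing separates the rounds. For j = 0 the integrand is
    constant.\<close>
  have A_int: "(\<integral>\<^sup>+zeta. A zeta i \<partial>laplace sig) = ennreal (U S j n (nxt_priv j ?x i))" for i
    using nn_integral_svt[of S "j - 1" n "nxt_priv j ?x i"] L.emeasure_space_1
    by (cases j) (simp_all add: A_def)
  define V where "V = (\<lambda>(eta, zeta, u). if dS S ?x + eta \<ge> ?t then A zeta (sample_tok v (priv S ?x) u)
     else B (sample_tok v (pub ?x) u))"
  have V: "(\<integral>\<^sup>+\<omega>. ennreal (pay (run_from S (bstep S z st) \<omega> n)) \<partial>stream_space rnd) = V z" for z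
  proof -
    obtain eta zeta u where z: "z = (eta, zeta, u)" by (metis prod_cases3)
    show ?thesis
    proof (cases "dS S ?x + eta \<ge> ?t")
      case True
      let ?y = "nxt_priv j ?x (sample_tok v (priv S ?x) u)"
      have "nxt_priv (if Suc (cnt st) = r then 0 else 1) = nxt_priv j"
        using Suc.prems by (auto simp: nxt_priv_def)
      then have st': "bstep S z st = \<lparr>outs = fst ?y, cur = snd ?y, cnt = Suc (cnt st), thr = theta + zeta, fin = (j = 0)\<rparr>"
        unfolding z bstep_eq[OF Suc.prems(2)] using True Suc.prems by (auto simp: Let_def)
      show ?thesis
      proof (cases "j = 0")
        case j: True
        then have "fin (bstep S z st)" by (simp add: st')
        from run_from_fin[OF this] show ?thesis
          using j True by (simp add: st'[unfolded z] V_def z A_def pay_def RS.emeasure_space_1)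
      next
        case False
        have "(\<integral>\<^sup>+\<omega>. ennreal (pay (run_from S (bstep S z st) \<omega> n)) \<partial>stream_space rnd)
          = ennreal (tp.svt (dS S) (G S (j - 1)) n ?y (theta + zeta))"
          using False Suc.prems finite_nxt(2)[of ?x j] unfolding st'
          by (subst Suc.IH[of _ "j - 1"]) auto
        then show ?thesis using False True by (simp add: V_def z A_def)
      qed
    next
      case False
      let ?y = "nxt ?x (sample_tok v (pub ?x) u)"
      have st': "bstep S z st = \<lparr>outs = fst ?y, cur = snd ?y, cnt = cnt st, thr = ?t, fin = False\<rparr>"
        unfolding z bstep_eq[OF Suc.prems(2)] using False by (auto simp: Let_def)
      have "(\<integral>\<^sup>+\<omega>. ennreal (pay (run_from S (bstep S z st) \<omega> n)) \<partial>stream_space rnd) = B (sample_tok v (pub ?x) u)"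
        using Suc.prems finite_nxt(1)[of ?x] unfolding st'
        by (subst Suc.IH[of _ j]) (auto simp: B_def)
      then show ?thesis using False by (simp add: V_def z)
    qed
  qed
  \<comment> \<open>The sampled index ranges over a countable set, so measurability reduces to a
    fixed index.\<close>
  have A_tok[measurable]: "(\<lambda>z. A (fst (snd z)) (sample_tok v (priv S ?x) (snd (snd z)))) \<in> borel_measurable (borel \<Otimes>\<^sub>M (borel \<Otimes>\<^sub>M borel))"
    by (rule measurable_compose_countable'[where f="\<lambda>i z. A (fst (snd z)) i" and I=UNIV]) auto
  have B_tok[measurable]: "(\<lambda>z. B (sample_tok v (pub ?x) (snd (snd z)))) \<in> borel_measurable (borel \<Otimes>\<^sub>M (borel \<Otimes>\<^sub>M borel))"
    by (rule measurable_compose_countable'[where f="\<lambda>i z. B i" and I=UNIV]) auto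
  have "(\<lambda>z. if dS S ?x + fst z \<ge> ?t then A (fst (snd z)) (sample_tok v (priv S ?x) (snd (snd z)))
     else B (sample_tok v (pub ?x) (snd (snd z)))) \<in> borel_measurable (borel \<Otimes>\<^sub>M (borel \<Otimes>\<^sub>M borel))"
    by measurable
  then have V_meas: "V \<in> borel_measurable rnd"
    using measurable_cong_sets[OF sets_rnd refl] by (simp add: V_def case_prod_unfold)
  have "(\<lambda>\<omega>. ennreal (pay (run_from S st \<omega> (Suc n)))) \<in> borel_measurable (stream_space rnd)"
    using Suc.prems by (intro pay_measurable measurable_state_run_from measurable_state_const) auto
  from R.nn_integral_stream_space[OF this]
  have "(\<integral>\<^sup>+\<omega>. ennreal (pay (run_from S st \<omega> (Suc n))) \<partial>stream_space rnd) = (\<integral>\<^sup>+z. V z \<partial>rnd)"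
    by (simp only: run_from_SCons V)
  also have "\<dots> = (\<integral>\<^sup>+eta. \<integral>\<^sup>+zeta. \<integral>\<^sup>+u. V (eta, zeta, u) \<partial>uniform01 \<partial>laplace sig \<partial>laplace (2 * sig))"
    by (rule nn_integral_triple[OF _ _ V_meas]) (rule L.sigma_finite_measure_axioms U1.sigma_finite_measure_axioms)+
  also have "\<dots> = (\<integral>\<^sup>+eta. \<integral>\<^sup>+zeta. (if dS S ?x + eta \<ge> ?t then (\<Sum>i<v. ennreal (priv S ?x i) * A zeta i)
      else (\<Sum>i<v. ennreal (pub ?x i) * B i)) \<partial>laplace sig \<partial>laplace (2 * sig))"
  proof (intro nn_integral_cong)
    fix eta zeta
    show "(\<integral>\<^sup>+u. V (eta, zeta, u) \<partial>uniform01) = (if dS S ?x + eta \<ge> ?t then (\<Sum>i<v. ennreal (priv S ?x i) * A zeta i)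
      else (\<Sum>i<v. ennreal (pub ?x i) * B i))"
      using nn_integral_sample_tok[of v "priv S ?x" "A zeta"] nn_integral_sample_tok[of v "pub ?x" B]
        less_imp_le[OF priv_pos] priv_sum tp.pub_nonneg tp.pub_sum
      by (auto simp: V_def)
  qed
  \<comment> \<open>Only the passing branch depends on zeta.\<close>
  also have "\<dots> = (\<integral>\<^sup>+eta. (if dS S ?x + eta \<ge> ?t then (\<Sum>i<v. ennreal (priv S ?x i) * ennreal (U S j n (nxt_priv j ?x i)))
      else (\<Sum>i<v. ennreal (pub ?x i) * B i)) \<partial>laplace (2 * sig))"
    by (intro nn_integral_cong) (auto simp: nn_integral_sum nn_integral_cmult A_int L.emeasure_space_1[simplified])
  also have "\<dots> = ennreal (1 - tp.below (?t - dS S ?x)) * (\<Sum>i<v. ennreal (priv S ?x i) * ennreal (U S j n (nxt_priv j ?x i)))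
     + ennreal (tp.below (?t - dS S ?x)) * (\<Sum>i<v. ennreal (pub ?x i) * B i)"
    using sig' by (intro nn_integral_laplace_threshold) auto
  also have "(\<Sum>i<v. ennreal (priv S ?x i) * ennreal (U S j n (nxt_priv j ?x i))) = ennreal (G S j (Suc n, ?x))"
    by (simp add: pr.payoff_def ennreal_mult'[symmetric] U_bounds less_imp_le[OF priv_pos] sum_ennreal)
  also have "(\<Sum>i<v. ennreal (pub ?x i) * B i) = ennreal (\<Sum>i<v. pub ?x i * tp.svt (dS S) (G S j) n (nxt ?x i) ?t)"
    by (simp add: B_def ennreal_mult'[symmetric] tp.svt_nonneg G_bounds tp.pub_nonneg sum_ennreal)
  also have "ennreal (1 - tp.below (?t - dS S ?x)) * ennreal (G S j (Suc n, ?x))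
     + ennreal (tp.below (?t - dS S ?x)) * ennreal (\<Sum>i<v. pub ?x i * tp.svt (dS S) (G S j) n (nxt ?x i) ?t)
    = ennreal (tp.svt (dS S) (G S j) (Suc n) ?x ?t)"
    using tp.below by (simp add: ennreal_mult'[symmetric] ennreal_plus[symmetric] G_bounds tp.svt_nonneg tp.pub_nonneg sum_nonneg
        del: ennreal_plus)
  finally show ?case .
qed

lemma measurable_state_brun: "measurable_state (batch_space sig) (\<lambda>w. brun S (fst w) (snd w) n)"
proof -
  have "measurable_state (batch_space sig) (\<lambda>w. st0 (fst w))"
    by (auto simp: measurable_state_def dpart_def dstates_def batch_space_def)
  then show ?thesis unfolding brun_eq
    by (rule measurable_state_run_from) (simp add: batch_space_def)
qed

text \<open>The initial threshold has the same law as a refreshed one, so the first search is an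
  ordinary round and a run counts r of them.\<close>

lemma nn_integral_brun:
  "(\<integral>\<^sup>+w. ennreal (pay (brun S (fst w) (snd w) n)) \<partial>batch_space sig) = ennreal (U S r n ({}, []))"
proof -
  interpret RS: prob_space "stream_space rnd" by (intro prob_space.prob_space_stream_space prob_space_rnd)
  have "(\<integral>\<^sup>+w. ennreal (pay (brun S (fst w) (snd w) n)) \<partial>batch_space sig)
     = (\<integral>\<^sup>+th. \<integral>\<^sup>+\<omega>. ennreal (pay (run_from S (st0 th) \<omega> n)) \<partial>stream_space rnd \<partial>laplace sig)"
    using pay_measurable[OF measurable_state_brun, of S n] unfolding batch_space_def
    by (subst RS.nn_integral_fst[symmetric]) (auto simp: brun_eq)
  also have "\<dots> = (\<integral>\<^sup>+th. ennreal (tp.svt (dS S) (G S (r - 1)) n ({}, []) (theta + th)) \<partial>laplace sig)"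
    using r by (intro nn_integral_cong) (subst nn_integral_run_from[where j = "r - 1"], auto)
  also have "\<dots> = ennreal (U S r n ({}, []))"
    using nn_integral_svt[of S "r - 1"] r by simp
  finally show ?thesis .
qed

end

section \<open>Privacy of one batch and of the whole algorithm\<close>

text \<open>The logit vectors form a set, so a new prompt whose vector already occurs changes
  nothing; otherwise exactly one summand is added.\<close>

lemma abs_sum_image_insert_diff_le:
  fixes g :: "'b \<Rightarrow> real"
  assumes "finite S'" "S = insert p S'" "\<And>z. \<bar>g z\<bar> \<le> B z" "\<And>z. B z \<ge> 0"
  shows "\<bar>(\<Sum>z\<in>h ` S. g z) - (\<Sum>z\<in>h ` S'. g z)\<bar> \<le> B (h p)"
proof (cases "h p \<in> h ` S'")
  case True
  then have "h ` S = h ` S'" unfolding assms(2) image_insert by (rule insert_absorb)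
  then show ?thesis using assms(4) by simp
next
  case False
  then have "(\<Sum>z\<in>h ` S. g z) = g (h p) + (\<Sum>z\<in>h ` S'. g z)"
    unfolding assms(2) image_insert using assms(1) by (intro sum.insert) auto
  then show ?thesis using assms(3) by simp
qed

text \<open>Coordinate i moves by at most \<open>softmax v (h p) i / s\<close>, and these bounds sum
  to \<open>1 / s\<close>. A uniform bound per coordinate would cost a factor v.\<close>

lemma dist_d_insert:
  assumes "v > 0" "s > 0" "finite S'" "S = insert p S'"
  shows "\<bar>dist_d v s (h ` S) z - dist_d v s (h ` S') z\<bar> \<le> 1 / s"
proof -
  let ?a = "\<lambda>S i. (\<Sum>z'\<in>h ` S. softmax v z' i) / s - softmax v z i"
  have "\<bar>\<bar>?a S i\<bar> - \<bar>?a S' i\<bar>\<bar> \<le> softmax v (h p) i / s" for i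
  proof -
    have "\<bar>\<bar>?a S i\<bar> - \<bar>?a S' i\<bar>\<bar> \<le> \<bar>?a S i - ?a S' i\<bar>" by (rule abs_triangle_ineq3)
    also have "\<dots> = \<bar>(\<Sum>z\<in>h ` S. softmax v z i) - (\<Sum>z\<in>h ` S'. softmax v z i)\<bar> / s"
      using assms by (simp add: diff_divide_distrib[symmetric])
    also have "\<dots> \<le> softmax v (h p) i / s"
      using assms softmax_pos[OF \<open>v > 0\<close>]
      by (intro divide_right_mono abs_sum_image_insert_diff_le[where B="\<lambda>z. softmax v z i"])
        (auto simp: less_imp_le)
    finally show ?thesis .
  qed
  then have "\<bar>\<Sum>i<v. \<bar>?a S i\<bar> - \<bar>?a S' i\<bar>\<bar> \<le> (\<Sum>i<v. softmax v (h p) i / s)"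
    by (intro order_trans[OF sum_abs] sum_mono)
  also have "\<dots> = 1 / s" using sum_softmax[OF \<open>v > 0\<close>] by (simp flip: sum_divide_distrib)
  finally show ?thesis by (simp add: dist_d_def sum_subtractf)
qed

lemma abs_clip_le:
  assumes "i < v" "c > 0" shows "\<bar>clip v c z i\<bar> \<le> c"
proof -
  have "z i \<le> Max (z ` {..<v})" using assms by (intro Max_ge) auto
  then show ?thesis using assms by (simp add: clip_def abs_le_iff)
qed

context batch_process begin

lemma dS_neighbors:
  assumes "finite S" "finite S'" "S = insert p S' \<or> S' = insert p S"
  shows "\<bar>dS S x - dS S' x\<bar> \<le> 1 / s"
proof -
  obtain O' y where x: "x = (O', y)" by force
  from assms(3) show ?thesis
  proof
    assume "S = insert p S'"
    from dist_d_insert[OF v s assms(2) this] show ?thesis by (simp add: dS_def x)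
  next
    assume "S' = insert p S"
    from dist_d_insert[OF v s assms(1) this] show ?thesis
      by (simp add: dS_def x abs_minus_commute)
  qed
qed

text \<open>Clipping confines each summand to [-c, c], so one prompt moves every private logit by at
  most \<open>c / (s * tau)\<close>.\<close>

lemma priv_neighbors:
  assumes "finite S" "finite S'" "S = insert p S' \<or> S' = insert p S" and alpha: "alpha > 1"
  shows "(\<Sum>i<v. priv S x i powr alpha * priv S' x i powr (1 - alpha))
    \<le> exp (alpha * (alpha - 1) * (c / (s * tau))\<^sup>2 / 2)"
proof -
  obtain O' y where x: "x = (O', y)" by force
  define h where "h = (\<lambda>p. logits (p @ y))"
  let ?z = "\<lambda>S i. (\<Sum>z\<in>h ` S. clip v c z i) / s / tau"
  have "\<bar>?z S i - ?z S' i\<bar> \<le> c / (s * tau)" if i: "i < v" for i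
  proof -
    have "\<bar>(\<Sum>z\<in>h ` S. clip v c z i) - (\<Sum>z\<in>h ` S'. clip v c z i)\<bar> \<le> c"
      using assms abs_sum_image_insert_diff_le[of S' S p "\<lambda>z. clip v c z i" "\<lambda>_. c" h]
        abs_sum_image_insert_diff_le[of S S' p "\<lambda>z. clip v c z i" "\<lambda>_. c" h] abs_clip_le[OF i c] c
      by (auto simp: abs_minus_commute)
    moreover have "?z S i - ?z S' i = ((\<Sum>z\<in>h ` S. clip v c z i) - (\<Sum>z\<in>h ` S'. clip v c z i)) / (s * tau)"
      by (simp add: diff_divide_distrib)
    ultimately show ?thesis using s tau by (simp add: abs_mult divide_right_mono)
  qed
  from softmax_renyi_le[OF v alpha this] show ?thesis
    by (simp add: priv_def x h_def)
qed

section \<open>The limit of truncated runs\<close>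

lemma brun_fin_mono:
  assumes "fin (brun S th \<omega> n)" "n \<le> m" shows "brun S th \<omega> m = brun S th \<omega> n"
  using assms(2) by (induction rule: dec_induct) (auto simp: bstep_fin assms(1))

lemma space_batch_space [simp]: "space (batch_space sig) = UNIV"
  by (simp add: batch_space_def space_pair_measure space_stream_space)

text \<open>Arbitrary sets of token sequences are uncountably many. The finite ones give a countable
  range, which makes tuples of batch outputs measurable for the full power set.\<close>

definition finite_outputs :: "nat list set option set" where
  "finite_outputs = insert None (Some ` {O'. finite O'})"

lemma countable_finite_outputs: "countable finite_outputs"
  unfolding finite_outputs_def by (intro countable_insert countable_image countable_Collect_finite)

end

context batch_payoff begin

text \<open>The sequence is eventually constant: either the run finishes and then stays put, or
  every truncation is scored as \<open>psi\<close>.\<close>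

lemma pay_tendsto: "(\<lambda>n. pay (brun S (fst w) (snd w) n)) \<longlonglongrightarrow> indicator E (bout S w)"
proof (cases "\<exists>n. fin (brun S (fst w) (snd w) n)")
  case True
  define N where "N = (LEAST n. fin (brun S (fst w) (snd w) n))"
  have N: "fin (brun S (fst w) (snd w) N)" unfolding N_def using True by (rule LeastI_ex)
  have out: "bout S w = Some (outs (brun S (fst w) (snd w) N))"
    using True by (simp add: batch_out_def N_def case_prod_unfold)
  have "eventually (\<lambda>n. pay (brun S (fst w) (snd w) n) = indicator E (bout S w)) sequentially"
    using eventually_ge_at_top[of N]
  proof eventually_elim
    case (elim n)
    from brun_fin_mono[OF N elim] show ?case by (simp add: pay_def N out phi_def)
  qed
  then show ?thesis by (rule tendsto_eventually)
next
  case False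
  then have "bout S w = None" by (simp add: batch_out_def case_prod_unfold)
  then show ?thesis using False by (simp add: pay_def psi_def)
qed

lemma pay_bounds: "0 \<le> pay st" "pay st \<le> 1"
  by (auto simp: pay_def phi_def psi_def)

lemma pay_brun_measurable: "(\<lambda>w. pay (brun S (fst w) (snd w) n)) \<in> borel_measurable (batch_space sig)"
proof -
  have "(\<lambda>w. enn2real (ennreal (pay (brun S (fst w) (snd w) n)))) \<in> borel_measurable (batch_space sig)"
    using pay_measurable[OF measurable_state_brun] by measurable
  then show ?thesis by (simp add: pay_bounds)
qed

lemma integral_pay_brun: "(\<integral>w. pay (brun S (fst w) (snd w) n) \<partial>batch_space sig) = U S r n ({}, [])"
proof -
  have "(\<integral>w. pay (brun S (fst w) (snd w) n) \<partial>batch_space sig)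
      = enn2real (\<integral>\<^sup>+w. ennreal (pay (brun S (fst w) (snd w) n)) \<partial>batch_space sig)"
    by (intro integral_eq_nn_integral pay_brun_measurable) (simp add: pay_bounds)
  then show ?thesis by (simp add: nn_integral_brun U_bounds)
qed

text \<open>The output is defined through a LEAST over an unbounded run; its indicator is measurable
  as a pointwise limit of truncated payoffs.\<close>

lemma indicator_bout_measurable: "(\<lambda>w. indicator E (bout S w) :: real) \<in> borel_measurable (batch_space sig)"
  by (rule borel_measurable_LIMSEQ_real[OF pay_tendsto pay_brun_measurable])

lemma sets_bout: "bout S -` E \<in> sets (batch_space sig)"
proof -
  have "(\<lambda>w. indicator E (bout S w) :: real) -` {1} \<inter> space (batch_space sig) \<in> sets (batch_space sig)"
    by (intro measurable_sets[OF indicator_bout_measurable]) auto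
  also have "(\<lambda>w. indicator E (bout S w) :: real) -` {1} \<inter> space (batch_space sig) = bout S -` E"
    by (auto simp: indicator_def)
  finally show ?thesis .
qed

lemma U_tendsto: "(\<lambda>n. U S r n ({}, [])) \<longlonglongrightarrow> measure (batch_space sig) (bout S -` E)"
proof -
  interpret prob_space "batch_space sig" by (rule prob_space_batch_space)
  have "(\<lambda>n. \<integral>w. pay (brun S (fst w) (snd w) n) \<partial>batch_space sig)
      \<longlonglongrightarrow> (\<integral>w. indicator E (bout S w) \<partial>batch_space sig)"
    by (rule integral_dominated_convergence[where w="\<lambda>_. 1"])
      (auto simp: pay_brun_measurable indicator_bout_measurable pay_tendsto pay_bounds)
  also have "(\<integral>w. indicator E (bout S w) \<partial>batch_space sig) = (\<integral>w. indicator (bout S -` E) w \<partial>batch_space sig)"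
    by (intro Bochner_Integration.integral_cong) (auto simp: indicator_def)
  also have "\<dots> = measure (batch_space sig) (bout S -` E)" by simp
  finally show ?thesis by (simp add: integral_pay_brun)
qed

text \<open>The additive term does not depend on the cutoff, so the inequality for truncated runs
  passes to the limit.\<close>

lemma bout_dp:
  assumes S: "finite S" "finite S'" "S = insert p S' \<or> S' = insert p S" and alpha: "alpha > 1"
    and rho: "rho = real r * ((1/2) * (c / (s * tau))\<^sup>2 + 2 / (s * sig)\<^sup>2)"
  shows "measure (batch_space sig) (bout S -` E) \<le> exp eps * measure (batch_space sig) (bout S' -` E)
    + exp ((alpha - 1) * (alpha * rho - eps)) / (alpha - 1) * (1 - 1 / alpha) powr alpha"
proof (rule LIMSEQ_le[OF U_tendsto])
  show "(\<lambda>n. exp eps * U S' r n ({}, []) + exp ((alpha - 1) * (alpha * rho - eps)) / (alpha - 1) * (1 - 1 / alpha) powr alpha)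
    \<longlonglongrightarrow> exp eps * measure (batch_space sig) (bout S' -` E)
    + exp ((alpha - 1) * (alpha * rho - eps)) / (alpha - 1) * (1 - 1 / alpha) powr alpha"
    by (intro tendsto_intros U_tendsto)
  have rho': "real r * ((c / (s * tau))\<^sup>2 / 2 + 2 * (1 / s / sig)\<^sup>2) = rho"
    unfolding rho by (simp add: power_divide)
  have "U S r n ({}, []) \<le> exp eps * U S' r n ({}, [])
      + exp ((alpha - 1) * (alpha * rho - eps)) / (alpha - 1) * (1 - 1 / alpha) powr alpha" for n
  proof (rule Holder_imp_dp[OF alpha U_bounds(1)])
    show "U S r n ({}, []) \<le> exp ((alpha - 1) * rho) * U S' r n ({}, []) powr (1 - 1 / alpha)"
      unfolding rho'[symmetric]
      by (rule pr.rounds_Holder[OF dS_neighbors[OF S] _ alpha _ _ _ _ priv_neighbors[OF S alpha]])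
        (use s less_imp_le[OF priv_pos] priv_sum priv_pos in auto)
  qed
  then show "\<exists>N. \<forall>n\<ge>N. U S r n ({}, []) \<le> exp eps * U S' r n ({}, [])
      + exp ((alpha - 1) * (alpha * rho - eps)) / (alpha - 1) * (1 - 1 / alpha) powr alpha" by blast
qed

end

context batch_process begin

lemma bout_measurable [measurable]: "bout S \<in> batch_space sig \<rightarrow>\<^sub>M count_space UNIV"
proof (rule measurableI)
  fix E :: "nat list set option set"
  interpret batch_payoff logits v eos ppub s r c tau taupub theta sig E ..
  show "bout S -` E \<inter> space (batch_space sig) \<in> sets (batch_space sig)" using sets_bout by simp
qed simp

text \<open>Finiteness is read off from the codomain \<open>dstates\<close> of a measurability
  statement.\<close>

lemma bout_finite: "bout S w \<in> finite_outputs"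
proof -
  have "(\<lambda>w. dpart (brun S (fst w) (snd w) n)) \<in> batch_space sig \<rightarrow>\<^sub>M count_space dstates" for n
  proof -
    interpret batch_payoff logits v eos ppub s r c tau taupub theta sig "{}" ..
    show ?thesis using measurable_state_brun by (simp add: measurable_state_def)
  qed
  from measurable_space[OF this, of w] have "finite (outs (brun S (fst w) (snd w) n))" for n
    by (simp add: dpart_def dstates_def)
  then show ?thesis by (auto simp: batch_out_def finite_outputs_def case_prod_unfold)
qed

section \<open>Combining the batches\<close>

definition combine :: "nat \<Rightarrow> (nat \<Rightarrow> nat list set option) \<Rightarrow> nat list set option" where
  "combine k res = (if \<forall>i\<in>{1..k}. res i \<noteq> None then Some (\<Union>i\<in>{1..k}. the (res i)) else None)"

lemma combine_cong: "(\<And>i. i \<in> {1..k} \<Longrightarrow> g i = h i) \<Longrightarrow> combine k g = combine k h"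
proof -
  assume eq: "\<And>i. i \<in> {1..k} \<Longrightarrow> g i = h i"
  then have "(\<forall>i\<in>{1..k}. g i \<noteq> None) \<longleftrightarrow> (\<forall>i\<in>{1..k}. h i \<noteq> None)" by simp
  moreover have "(\<Union>i\<in>{1..k}. the (g i)) = (\<Union>i\<in>{1..k}. the (h i))"
    using eq by (intro SUP_cong) auto
  ultimately show ?thesis unfolding combine_def by (simp only:)
qed

context
  fixes f :: "nat list \<Rightarrow> nat" and k :: nat
begin

abbreviation "aout \<equiv> alg1_out logits v eos ppub s r c tau taupub theta f k"
abbreviation "batch D i \<equiv> {p \<in> D. f p = i}"

lemma aout_eq: "aout D \<omega> = combine k (\<lambda>i. bout (batch D i) (\<omega> i))"
  by (simp add: alg1_out_def combine_def)

lemma aout_measurable: "aout D \<in> alg1_space k sig \<rightarrow>\<^sub>M count_space UNIV"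
proof -
  let ?M = "alg1_space k sig" and ?I = "{1..k}"
  let ?g = "\<lambda>\<omega>. \<lambda>i\<in>?I. bout (batch D i) (\<omega> i)"
  have comp: "(\<lambda>\<omega>. bout (batch D i) (\<omega> i)) \<in> ?M \<rightarrow>\<^sub>M count_space UNIV" if "i \<in> ?I" for i
    unfolding alg1_space_def using that
    by (intro measurable_compose[OF _ bout_measurable] measurable_component_singleton)
  \<comment> \<open>Any map out of a \<open>count_space\<close> is measurable, so it suffices to
    view the tuple of outputs as a random element of a countable set.\<close>
  have "?g \<in> ?M \<rightarrow>\<^sub>M count_space (?I \<rightarrow>\<^sub>E finite_outputs)"
  proof (subst measurable_count_space_eq_countable)
    show "countable (?I \<rightarrow>\<^sub>E finite_outputs)"
      by (intro countable_PiE countable_finite_outputs) auto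
    show "?g \<in> space ?M \<rightarrow> (?I \<rightarrow>\<^sub>E finite_outputs) \<and> (\<forall>a\<in>?I \<rightarrow>\<^sub>E finite_outputs. ?g -` {a} \<inter> space ?M \<in> sets ?M)"
    proof (intro conjI ballI)
      show "?g \<in> space ?M \<rightarrow> (?I \<rightarrow>\<^sub>E finite_outputs)" using bout_finite by auto
      fix a assume a: "a \<in> ?I \<rightarrow>\<^sub>E finite_outputs"
      have "?g -` {a} \<inter> space ?M = {\<omega> \<in> space ?M. \<forall>i\<in>?I. bout (batch D i) (\<omega> i) = a i}"
        using a by (auto simp: fun_eq_iff PiE_def extensional_def restrict_def)
      also have "\<dots> \<in> sets ?M"
      proof (intro sets.sets_Collect_finite_All)
        fix i assume "i \<in> ?I"
        from measurable_sets[OF comp[OF this], of "{a i}"]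
        show "{\<omega> \<in> space ?M. bout (batch D i) (\<omega> i) = a i} \<in> sets ?M"
          by (simp add: vimage_def Int_def conj_commute)
      qed auto
      finally show "?g -` {a} \<inter> space ?M \<in> sets ?M" .
    qed
  qed
  then have "(\<lambda>\<omega>. combine k (?g \<omega>)) \<in> ?M \<rightarrow>\<^sub>M count_space UNIV"
    by (rule measurable_compose) simp
  moreover have "combine k (?g \<omega>) = aout D \<omega>" for \<omega>
    unfolding aout_eq by (intro combine_cong) simp
  ultimately show ?thesis by simp
qed

lemma prob_space_alg1_space: "prob_space (alg1_space k sig)"
  unfolding alg1_space_def by (intro prob_space_PiM prob_space_batch_space)

lemma prob_space_alg1: "prob_space (alg1 logits v eos ppub s r c tau taupub theta sig f k D)"
  unfolding alg1_def by (rule prob_space.prob_space_distr[OF prob_space_alg1_space aout_measurable])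

lemma emeasure_alg1:
  "emeasure (alg1 logits v eos ppub s r c tau taupub theta sig f k D) E
    = (\<integral>\<^sup>+\<omega>. indicator E (aout D \<omega>) \<partial>alg1_space k sig)"
proof -
  have "emeasure (alg1 logits v eos ppub s r c tau taupub theta sig f k D) E
      = emeasure (alg1_space k sig) (aout D -` E \<inter> space (alg1_space k sig))"
    unfolding alg1_def by (rule emeasure_distr[OF aout_measurable]) simp
  also have "\<dots> = (\<integral>\<^sup>+\<omega>. indicator (aout D -` E \<inter> space (alg1_space k sig)) \<omega> \<partial>alg1_space k sig)"
    using measurable_sets[OF aout_measurable, of E D] by simp
  also have "\<dots> = (\<integral>\<^sup>+\<omega>. indicator E (aout D \<omega>) \<partial>alg1_space k sig)"
    by (intro nn_integral_cong) (auto simp: indicator_def)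
  finally show ?thesis .
qed

lemma alg1_dp:
  assumes f: "\<forall>p. set p \<subseteq> {..<v} \<longrightarrow> f p \<in> {1..k}" and alpha: "alpha > 1"
    and rho: "rho = real r * ((1/2) * (c / (s * tau))\<^sup>2 + 2 / (s * sig)\<^sup>2)"
  shows "dp v (alg1 logits v eos ppub s r c tau taupub theta sig f k) eps
    (exp ((alpha - 1) * (alpha * rho - eps)) / (alpha - 1) * (1 - 1 / alpha) powr alpha)"
    (is "dp v ?A eps ?delta")
  unfolding dp_def
proof (intro allI impI ballI)
  fix D D' and E :: "nat list set option set"
  assume DD: "finite D \<and> finite D' \<and> (\<forall>p\<in>D \<union> D'. set p \<subseteq> {..<v}) \<and> neighbors D D'"
  then obtain p where p: "D = insert p D' \<or> D' = insert p D" by (auto simp: neighbors_def)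
  define i where "i = f p"
  have i: "i \<in> {1..k}" using f p DD by (auto simp: i_def)
  have S: "finite (batch D i)" "finite (batch D' i)" "batch D i = insert p (batch D' i) \<or> batch D' i = insert p (batch D i)"
    using DD p by (auto simp: i_def)
  have other: "batch D j = batch D' j" if "j \<noteq> i" for j using p that by (auto simp: i_def)
  define I where "I = {1..k} - {i}"
  have I: "finite I" "i \<notin> I" "insert i I = {1..k}" using i by (auto simp: I_def)
  interpret PS: product_prob_space "\<lambda>_. batch_space sig" UNIV
    by (intro product_prob_spaceI prob_space_batch_space)
  interpret PI: prob_space "PiM I (\<lambda>_. batch_space sig)" by (intro prob_space_PiM prob_space_batch_space)
  have delta: "?delta \<ge> 0" using alpha by simp
  have meas: "(\<lambda>\<omega>. indicator E (aout D \<omega>) :: ennreal) \<in> borel_measurable (PiM (insert i I) (\<lambda>_. batch_space sig))" for D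
    using measurable_compose[OF aout_measurable, of "indicator E" borel D] by (simp add: I alg1_space_def)
  \<comment> \<open>Tonelli's theorem, with the noise of batch i innermost.\<close>
  have split: "emeasure (?A D) E = (\<integral>\<^sup>+x. \<integral>\<^sup>+y. indicator E (aout D (x(i := y))) \<partial>batch_space sig \<partial>PiM I (\<lambda>_. batch_space sig))" for D
    unfolding emeasure_alg1 alg1_space_def
    using PS.product_nn_integral_insert[OF I(1,2) meas] by (simp add: I)
  have inner: "(\<lambda>x. \<integral>\<^sup>+y. indicator E (aout D (x(i := y))) \<partial>batch_space sig) \<in> borel_measurable (PiM I (\<lambda>_. batch_space sig))" for D
  proof -
    have "(\<lambda>z. indicator E (aout D ((\<lambda>(x, y). x(i := y)) z)) :: ennreal)
       \<in> borel_measurable (PiM I (\<lambda>_. batch_space sig) \<Otimes>\<^sub>M batch_space sig)"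
      by (rule measurable_compose[OF measurable_add_dim meas])
    then show ?thesis by (intro sigma_finite_measure.borel_measurable_nn_integral[OF prob_space_imp_sigma_finite[OF prob_space_batch_space]]) (simp add: case_prod_unfold)
  qed
  have le: "(\<integral>\<^sup>+y. indicator E (aout D (x(i := y))) \<partial>batch_space sig)
     \<le> ennreal (exp eps) * (\<integral>\<^sup>+y. indicator E (aout D' (x(i := y))) \<partial>batch_space sig) + ennreal ?delta" for x
  proof -
    \<comment> \<open>An event for batch i alone, given the noise x of the others. It is written
      with the batches of D but serves D' too, since these agree away from i.\<close>
    define E' where "E' = {b. combine k (\<lambda>j. if j = i then b else bout (batch D j) (x j)) \<in> E}"
    interpret batch_payoff logits v eos ppub s r c tau taupub theta sig E' ..
    have *: "(\<integral>\<^sup>+y. indicator E (aout D'' (x(i := y))) \<partial>batch_space sig)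
        = ennreal (measure (batch_space sig) (bout (batch D'' i) -` E'))" if "D'' = D \<or> D'' = D'" for D''
    proof -
      have "aout D'' (x(i := y)) \<in> E \<longleftrightarrow> y \<in> bout (batch D'' i) -` E'" for y
      proof -
        have "aout D'' (x(i := y)) = combine k (\<lambda>j. if j = i then bout (batch D'' i) y else bout (batch D j) (x j))"
          unfolding aout_eq using that other by (intro combine_cong) auto
        then show ?thesis by (simp add: E'_def)
      qed
      then have "(\<integral>\<^sup>+y. indicator E (aout D'' (x(i := y))) \<partial>batch_space sig)
        = (\<integral>\<^sup>+y. indicator (bout (batch D'' i) -` E') y \<partial>batch_space sig)"
        by (intro nn_integral_cong) (simp add: indicator_def)
      also have "\<dots> = emeasure (batch_space sig) (bout (batch D'' i) -` E')" using sets_bout by simp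
      finally show ?thesis by (simp add: finite_measure.emeasure_eq_measure[OF prob_space.finite_measure[OF prob_space_batch_space]])
    qed
    have "ennreal (measure (batch_space sig) (bout (batch D i) -` E'))
      \<le> ennreal (exp eps * measure (batch_space sig) (bout (batch D' i) -` E') + ?delta)"
      by (intro ennreal_leI bout_dp[OF S alpha rho])
    also have "\<dots> = ennreal (exp eps) * ennreal (measure (batch_space sig) (bout (batch D' i) -` E')) + ennreal ?delta"
      using delta by (simp add: ennreal_mult')
    finally show ?thesis by (simp add: *)
  qed
  have "emeasure (?A D) E \<le> (\<integral>\<^sup>+x. ennreal (exp eps) * (\<integral>\<^sup>+y. indicator E (aout D' (x(i := y))) \<partial>batch_space sig)
      + ennreal ?delta \<partial>PiM I (\<lambda>_. batch_space sig))"
    unfolding split by (intro nn_integral_mono le)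
  also have "\<dots> = ennreal (exp eps) * emeasure (?A D') E + ennreal ?delta"
    unfolding split using inner by (subst nn_integral_add) (auto simp: nn_integral_cmult PI.emeasure_space_1)
  finally have "emeasure (?A D) E \<le> ennreal (exp eps) * emeasure (?A D') E + ennreal ?delta" .
  moreover have "finite_measure (?A D)" for D by (rule prob_space.finite_measure[OF prob_space_alg1])
  ultimately have "ennreal (measure (?A D) E) \<le> ennreal (exp eps * measure (?A D') E + ?delta)"
    using delta by (simp add: finite_measure.emeasure_eq_measure ennreal_mult')
  then show "measure (?A D) E \<le> exp eps * measure (?A D') E + ?delta"
    using delta by (subst (asm) ennreal_le_iff) (auto intro!: add_nonneg_nonneg)
qed

end

end

section \<open>Choice of the order alpha\<close>

theorem theorem1:
  fixes logits :: "nat list \<Rightarrow> nat \<Rightarrow> real" and v eos :: nat and ppub :: "nat list"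
    and s :: real and r :: nat and c tau taupub theta sig :: real
    and f :: "nat list \<Rightarrow> nat" and k :: nat and rho :: real
  assumes "eos < v" and "set ppub \<subseteq> {..<v}"
    and "s > 0" and "r > 0" and "c > 0" and "tau > 0" and "taupub > 0" and "sig > 0"
    and "\<forall>p. set p \<subseteq> {..<v} \<longrightarrow> f p \<in> {1..k}"
    and "rho = real r * ((1/2) * (c / (s * tau))\<^sup>2 + 2 / (s * sig)\<^sup>2)"
  shows "(\<forall>eps \<ge> 0. dp v (alg1 logits v eos ppub s r c tau taupub theta sig f k) eps
            (INF alpha \<in> {1<..}. exp ((alpha - 1) * (alpha * rho - eps)) / (alpha - 1)
                                   * (1 - 1 / alpha) powr alpha))
       \<and> (\<forall>delta. 0 < delta \<and> delta \<le> 1 \<longrightarrow>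
            dp v (alg1 logits v eos ppub s r c tau taupub theta sig f k)
               (rho + sqrt (4 * rho * ln (1 / delta))) delta)"
proof -
  interpret batch_process logits v eos ppub s r c tau taupub theta sig
    using assms by unfold_locales auto
  let ?A = "alg1 logits v eos ppub s r c tau taupub theta sig f k"
  let ?d = "\<lambda>alpha eps. exp ((alpha - 1) * (alpha * rho - eps)) / (alpha - 1) * (1 - 1 / alpha) powr alpha"
  have dp: "dp v ?A eps (?d alpha eps)" if "alpha > 1" for alpha eps
    by (rule alg1_dp[OF assms(9) that assms(10)])
  have "dp v ?A eps (INF alpha \<in> {1<..}. ?d alpha eps)" for eps
    unfolding dp_def
  proof (intro allI impI ballI)
    fix D D' E
    assume D: "finite D \<and> finite D' \<and> (\<forall>p\<in>D \<union> D'. set p \<subseteq> {..<v}) \<and> neighbors D D'"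
      and E: "E \<in> sets (?A D)"
    \<comment> \<open>The difference is a lower bound for the additive terms of all orders at once,
      hence for their infimum.\<close>
    have "measure (?A D) E - exp eps * measure (?A D') E \<le> (INF alpha \<in> {1<..}. ?d alpha eps)"
    proof (rule cINF_greatest)
      fix alpha :: real assume "alpha \<in> {1<..}"
      then show "measure (?A D) E - exp eps * measure (?A D') E \<le> ?d alpha eps"
        using dp[of alpha eps] D E unfolding dp_def by force
    qed (use gt_ex in auto)
    then show "measure (?A D) E \<le> exp eps * measure (?A D') E + (INF alpha \<in> {1<..}. ?d alpha eps)"
      by simp
  qed
  moreover have "dp v ?A (rho + sqrt (4 * rho * ln (1 / delta))) delta" if delta: "0 < delta" "delta \<le> 1" for delta
  proof (cases "delta = 1")
    \<comment> \<open>At delta = 1 the order chosen below would be 1, which is excluded; the claim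
      holds because probabilities are at most 1.\<close>
    case True
    show ?thesis unfolding dp_def True
      using prob_space.prob_le_1[OF prob_space_alg1]
      by (auto intro!: order_trans[OF prob_space.prob_le_1[OF prob_space_alg1]])
  next
    case False
    define L where "L = ln (1 / delta)"
    have L: "L > 0" using delta False by (simp add: L_def)
    have rho: "rho > 0" using assms by (auto intro!: mult_pos_pos add_nonneg_pos)
    \<comment> \<open>The order is \<open>1 + a\<close>. For the given epsilon, the exponent
      \<open>a * ((1 + a) * rho - ?eps)\<close> is quadratic in a with minimum \<open>- L\<close> at
      this value.\<close>
    define a where "a = sqrt (L / rho)"
    have a: "a > 0" "a * a = L / rho" using L rho by (auto simp: a_def)
    let ?eps = "rho + sqrt (4 * rho * L)"
    have "L = a * a * rho" using a rho by simp
    then have "4 * rho * L = (2 * rho * a)\<^sup>2"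
      by (simp add: power2_eq_square algebra_simps)
    then have eps: "?eps = rho + 2 * rho * a" using a rho by simp
    have "a * ((1 + a) * rho - ?eps) = - (a * a) * rho" unfolding eps by (simp add: algebra_simps)
    also have "\<dots> = - L" using a rho by simp
    finally have ex: "exp (a * ((1 + a) * rho - ?eps)) = delta"
      using delta by (simp add: L_def exp_minus ln_div)
    have g: "1 - 1 / (1 + a) = a / (1 + a)" using a by (simp add: field_simps)
    \<comment> \<open>The factor besides the exponential is at most 1, so delta is governed by the
      exponential alone.\<close>
    have "(a / (1 + a)) powr (1 + a) \<le> (a / (1 + a)) powr 1" using a by (intro powr_mono') auto
    also have "\<dots> = a / (1 + a)" using a by simp
    also have "\<dots> \<le> a" using a by (simp add: divide_le_eq)
    finally have "(a / (1 + a)) powr (1 + a) / a \<le> 1" using a by simp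
    then have "?d (1 + a) ?eps \<le> delta"
      using mult_left_mono[of "(a / (1 + a)) powr (1 + a) / a" 1 delta] delta by (simp add: ex g)
    moreover have "dp v ?A ?eps (?d (1 + a) ?eps)" using a by (intro dp) simp
    ultimately show ?thesis unfolding dp_def L_def[symmetric] by (meson add_left_mono order_trans)
  qed
  ultimately show ?thesis by blast
qed

end
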